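(* Fix an integer $N>0$ and real powers $n_0 < \cdots < n_{N-1} < M$. Also fix real scalars $\rho > 0$ and $c_{n_0}, \dots, c_{n_{N-1}}, c'$, and define $$f(x) := \sum_{j=0}^{N-1} c_{n_j} x^{n_j} + c' x^M .$$ Then the following are equivalent: (1) The entrywise map $f[-]$ preserves total non-negativity on rank-one matrices in $\mathrm{HTN}_N((0,\rho))$. (2) The entrywise map $f[-]$ preserves positivity on rank-one matrices in $\mathrm{HTN}_N((0,\rho))$. (3) Either all $c_{n_j}, c' \geqslant 0$; or $c_{n_j} > 0$ for all $j$ and $c' \geqslant -\mathcal{C}^{-1}$, where $$\mathcal{C} = \sum_{j=0}^{N-1} \frac{V(\mathbf{n}_j)^2}{V(\mathbf{n})^2} \frac{\rho^{M - n_j}}{c_{n_j}},$$ with $\mathbf{n} := (n_0, \dots, n_{N-1})$ and $\mathbf{n}_j := (n_0, \dots, n_{j-1}, n_{j+1}, \dots, n_{N-1}, M)$.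
   Context: A real matrix is totally non-negative if all its minors are non-negative. For $I \subset [0,+\infty)$, $\mathrm{HTN}_N(I)$ is the set of $N\times N$ Hankel totally non-negative matrices with entries in $I$ (such matrices are automatically positive semidefinite). For $A=(a_{jk})$ with entries in the domain of $f$, $f[A] := (f(a_{jk}))$. The map $f[-]$ preserves total non-negativity (resp. positivity) on a set of such matrices if $f[A]$ is totally non-negative (resp. positive semidefinite) for every $A$ in the set. For a tuple $(t_0,\dots,t_{k-1})$, $V(t_0,\dots,t_{k-1}) := \prod_{0 \leqslant i < j \leqslant k-1} (t_j - t_i)$ (an empty product is $1$). *)

theory Defs
  imports
    Complex_Main
    "Jordan_Normal_Form.DL_Rank"
    "Jordan_Normal_Form.DL_Submatrix"
begin

definition totally_nonneg :: "real mat \<Rightarrow> bool" where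
  "totally_nonneg A \<longleftrightarrow>
     (\<forall>I J. I \<subseteq> {..<dim_row A} \<and> J \<subseteq> {..<dim_col A} \<and> card I = card J
        \<longrightarrow> det (submatrix A I J) \<ge> 0)"

definition pos_semidef :: "real mat \<Rightarrow> bool" where
  "pos_semidef A \<longleftrightarrow>
     square_mat A \<and> transpose_mat A = A \<and> (\<forall>v \<in> carrier_vec (dim_row A). v \<bullet> (A *\<^sub>v v) \<ge> 0)"

definition hankel_mat :: "real mat \<Rightarrow> bool" where
  "hankel_mat A \<longleftrightarrow>
     (\<exists>s. \<forall>i < dim_row A. \<forall>j < dim_col A. A $$ (i, j) = s (i + j))"

definition HTN :: "nat \<Rightarrow> real set \<Rightarrow> real mat set" where
  "HTN N I = {A \<in> carrier_mat N N. hankel_mat A \<and> totally_nonneg A \<and> elements_mat A \<subseteq> I}"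

text \<open>The entrywise map f[-] is \<^const>\<open>map_mat\<close>.\<close>

definition preserves_total_nonneg_on :: "(real \<Rightarrow> real) \<Rightarrow> real mat set \<Rightarrow> bool" where
  "preserves_total_nonneg_on f S \<longleftrightarrow> (\<forall>A \<in> S. totally_nonneg (map_mat f A))"

definition preserves_positivity_on :: "(real \<Rightarrow> real) \<Rightarrow> real mat set \<Rightarrow> bool" where
  "preserves_positivity_on f S \<longleftrightarrow> (\<forall>A \<in> S. pos_semidef (map_mat f A))"

definition vandermonde :: "real list \<Rightarrow> real" where
  "vandermonde t = (\<Prod>j < length t. \<Prod>i < j. t ! j - t ! i)"

end

theory Submission
  imports Defs "Jordan_Normal_Form.DL_Rank_Submatrix"
begin

text \<open>
  A rank-one Hankel matrix with positive entries is geometric, with entries $a r^{p+q}$, so \<open>f\<close> turns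
  it into a Hankel matrix with entries $\sum_m w_m y_m^{p+q}$, where $w_m$ is the coefficient of the
  power $e_m$ times $a^{e_m}$ and $y_m = r^{e_m}$; the index \<open>N\<close> stands for the extra power \<open>M\<close>. This is
  the moment matrix of a signed measure on the \<open>N + 1\<close> nodes $y_0, \dots, y_N$. The proof closes a
  cycle: total non-negativity implies positivity, positivity implies the coefficient condition, and
  the coefficient condition implies total non-negativity.

  The first implication is Sylvester's criterion for semidefinite matrices
  (\<open>quadratic_form_nonneg_of_principal_minors\<close>), obtained by Schur complements.

  For the second, the quadratic form of the moment matrix at the coefficient vector of a polynomial
  \<open>P\<close> of degree below \<open>N\<close> is $\sum_m w_m P(y_m)^2$. The values of \<open>P\<close> at the first \<open>N\<close> nodes are
  arbitrary, and they determine $P(y_N)$ through the Lagrange coefficients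
  $d_l = \prod_{m \neq l} (y_N - y_m) / (y_l - y_m)$. A polynomial that vanishes at all but one of these
  nodes, together with $a \to 0$, gives the signs of the coefficients. If $c'$ is negative, the values
  $d_l / w_l$ are extremal and give $1 + c' \sum_l d_l^2 a^{M - n_l} / c_l \geq 0$; as $r \to 1$ and
  $a \to \rho$ the sum tends to the constant \<open>C\<close>, because
  $d_l^2 \to V(\mathbf{n}_l)^2 / V(\mathbf{n})^2$
  (\<open>coefficients_of_psd\<close>).

  For the third, Andreief's identity writes \<open>k!\<close> times a \<open>k\<close>-minor as a sum over maps $\phi$ from the
  \<open>k\<close> positions to the \<open>N + 1\<close> nodes, with terms $\prod_p w_{\phi(p)}$ times the square of a Vandermonde
  product times two Schur polynomials (\<open>exponential_sum_minor\<close>). If all coefficients are non-negative,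
  so are the terms. Otherwise only injective $\phi$ that use the last node contribute negatively. In such
  a $\phi$ the last node is exchanged for the largest unused one. If $r \leq 1$, this enlarges the Schur
  polynomials, which are monotone, and changes the Vandermonde factors by ratios that, by convexity of
  $t \mapsto r^t$, are controlled by the ratios of exponent differences that make up \<open>C\<close>
  (\<open>minor_weight_exchange\<close>). Summed up, the negative terms are in absolute value at most $-c' C$ times the positive ones. The case $r > 1$ follows by reversing the
  order of rows and columns.
\<close>

section \<open>Determinants of arrays\<close>

text \<open>Minors pick rows and columns by index functions, so they are handled as determinants of
  functions of two indices.\<close>

abbreviation array_det :: "nat \<Rightarrow> (nat \<Rightarrow> nat \<Rightarrow> real) \<Rightarrow> real" where
  "array_det k a \<equiv> det (mat k k (\<lambda>(p, q). a p q))"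

lemma array_det_leibniz:
  "array_det k a = (\<Sum>\<pi> | \<pi> permutes {..<k}. signof \<pi> * (\<Prod>p<k. a p (\<pi> p)))"
proof -
  have "array_det k a = (\<Sum>\<pi> | \<pi> permutes {0..<k}. signof \<pi> * (\<Prod>p = 0..<k. a p (\<pi> p)))"
    unfolding det_def'[OF mat_carrier]
  proof (intro sum.cong refl arg_cong2[where f = "(*)"] prod.cong)
    fix \<pi> p assume "\<pi> \<in> {\<pi>. \<pi> permutes {0..<k}}" "p \<in> {0..<k}"
    then have "p < k" "\<pi> p < k"
      using permutes_in_image[of \<pi> "{0..<k}" p] by auto
    then show "mat k k (\<lambda>(p, q). a p q) $$ (p, \<pi> p) = a p (\<pi> p)" by simp
  qed
  then show ?thesis by (simp add: atLeast0LessThan)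
qed

lemma array_det_cong:
  assumes "\<And>p q. p < k \<Longrightarrow> q < k \<Longrightarrow> a p q = b p q"
  shows "array_det k a = array_det k b"
  by (rule arg_cong[where f = det], rule eq_matI) (use assms in auto)

lemma array_det_transpose: "array_det k (\<lambda>p q. a q p) = array_det k a"
proof -
  have "transpose_mat (mat k k (\<lambda>(p, q). a p q)) = mat k k (\<lambda>(p, q). a q p)"
    by (rule eq_matI) auto
  then show ?thesis using det_transpose[of "mat k k (\<lambda>(p, q). a p q)" k] by simp
qed

lemma array_det_permute_rows:
  assumes "\<sigma> permutes {..<k}"
  shows "array_det k (\<lambda>p q. a (\<sigma> p) q) = signof \<sigma> * array_det k a"
proof -
  have \<sigma>: "\<sigma> permutes {0..<k}" using assms by (simp add: atLeast0LessThan)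
  have "mat k k (\<lambda>(p, q). mat k k (\<lambda>(p, q). a p q) $$ (\<sigma> p, q)) = mat k k (\<lambda>(p, q). a (\<sigma> p) q)"
    by (rule eq_matI) (use permutes_in_image[OF \<sigma>] in auto)
  then show ?thesis
    using det_permute_rows[OF mat_carrier \<sigma>, of "\<lambda>(p, q). a p q"] by simp
qed

lemma array_det_permute_both:
  assumes "\<sigma> permutes {..<k}"
  shows "array_det k (\<lambda>p q. a (\<sigma> p) (\<sigma> q)) = array_det k a"
proof -
  have "array_det k (\<lambda>p q. a (\<sigma> p) (\<sigma> q)) = signof \<sigma> * array_det k (\<lambda>p q. a p (\<sigma> q))"
    using array_det_permute_rows[OF assms, of "\<lambda>p q. a p (\<sigma> q)"] .
  also have "array_det k (\<lambda>p q. a p (\<sigma> q)) = array_det k (\<lambda>p q. a q (\<sigma> p))"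
    using array_det_transpose[of k "\<lambda>p q. a p (\<sigma> q)"] by simp
  also have "\<dots> = signof \<sigma> * array_det k (\<lambda>p q. a q p)"
    using array_det_permute_rows[OF assms, of "\<lambda>p q. a q p"] .
  also have "array_det k (\<lambda>p q. a q p) = array_det k a"
    by (rule array_det_transpose)
  finally show ?thesis by (simp add: sign_def)
qed

lemma array_det_scale_rows:
  "array_det k (\<lambda>p q. c p * a p q) = (\<Prod>p<k. c p) * array_det k a"
  unfolding array_det_leibniz by (simp add: prod.distrib sum_distrib_left mult_ac)

lemma array_det_scale_cols:
  "array_det k (\<lambda>p q. c q * a p q) = (\<Prod>q<k. c q) * array_det k a"
  using array_det_transpose[of k "\<lambda>p q. c q * a p q"] array_det_transpose[of k a]
    array_det_scale_rows[of k c "\<lambda>p q. a q p"] by simp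

lemma array_det_sum_rows:
  assumes "\<And>p. p < k \<Longrightarrow> finite (S p)"
  shows "array_det k (\<lambda>p q. \<Sum>m\<in>S p. a p m q)
       = (\<Sum>\<phi>\<in>PiE {..<k} S. array_det k (\<lambda>p q. a p (\<phi> p) q))"
proof -
  have "array_det k (\<lambda>p q. \<Sum>m\<in>S p. a p m q)
      = (\<Sum>\<pi> | \<pi> permutes {..<k}. \<Sum>\<phi>\<in>PiE {..<k} S. signof \<pi> * (\<Prod>p<k. a p (\<phi> p) (\<pi> p)))"
    unfolding array_det_leibniz using assms
    by (subst prod_sum_PiE) (auto simp: sum_distrib_left)
  also have "\<dots> = (\<Sum>\<phi>\<in>PiE {..<k} S. array_det k (\<lambda>p q. a p (\<phi> p) q))"
    unfolding array_det_leibniz by (rule sum.swap)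
  finally show ?thesis .
qed

text \<open>One Gaussian elimination step with arbitrary multipliers, each row being reduced by the rows
  above it. Reducing by the first row gives Schur complements; reducing by the preceding row gives the
  branching rule for Schur polynomials.\<close>

lemma array_det_eliminate_first_column:
  assumes "\<And>p. p < k \<Longrightarrow> a (Suc p) 0 = (\<Sum>l\<le>p. c p l * a l 0)"
  shows "array_det (Suc k) a
       = a 0 0 * array_det k (\<lambda>p q. a (Suc p) (Suc q) - (\<Sum>l\<le>p. c p l * a l (Suc q)))"
proof -
  let ?n = "Suc k"
  \<comment> \<open>The row operations are the multiplication by the unitriangular matrix \<open>L\<close>.\<close>
  define L where "L = mat ?n ?n (\<lambda>(p, l). if p = l then 1 else if l < p then - c (p - 1) l else 0)"
  define A where "A = mat ?n ?n (\<lambda>(p, q). a p q)"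
  have carr: "L \<in> carrier_mat ?n ?n" "A \<in> carrier_mat ?n ?n"
    by (simp_all add: L_def A_def)
  have "det L = prod_list (diag_mat L)"
    by (rule det_lower_triangular[OF _ carr(1)]) (simp add: L_def)
  also have "diag_mat L = map (\<lambda>_. 1) [0..<?n]"
    unfolding diag_mat_def by (rule map_cong) (auto simp: L_def)
  also have "prod_list \<dots> = 1" by (simp add: map_replicate_const)
  finally have detL: "det L = 1" .
  have entry0: "(L * A) $$ (0, q) = a 0 q" if "q < ?n" for q
  proof -
    have "(L * A) $$ (0, q) = (\<Sum>l\<in>{0..<?n}. (if 0 = l then 1 else 0) * a l q)"
      using that unfolding L_def A_def times_mat_def scalar_prod_def
      by (auto intro!: sum.cong)
    also have "\<dots> = (\<Sum>l\<in>{0}. (if 0 = l then 1 else 0) * a l q)"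
      by (rule sum.mono_neutral_right) auto
    finally show ?thesis by simp
  qed
  have entry: "(L * A) $$ (Suc p, q) = a (Suc p) q - (\<Sum>l\<le>p. c p l * a l q)"
    if "p < k" "q < ?n" for p q
  proof -
    have "(L * A) $$ (Suc p, q)
        = (\<Sum>l\<in>{0..<?n}. (if Suc p = l then 1 else if l < Suc p then - c p l else 0) * a l q)"
      using that unfolding L_def A_def times_mat_def scalar_prod_def
      by (auto intro!: sum.cong)
    also have "\<dots> = (\<Sum>l\<in>insert (Suc p) {..p}.
        (if Suc p = l then 1 else if l < Suc p then - c p l else 0) * a l q)"
      by (rule sum.mono_neutral_right) (use that in auto)
    also have "\<dots> = a (Suc p) q + (\<Sum>l\<le>p. - c p l * a l q)"
      by (subst sum.insert) (auto intro!: sum.cong)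
    finally show ?thesis by (simp add: sum_negf)
  qed
  have below: "(L * A) $$ (p, 0) = 0" if "0 < p" "p < ?n" for p
    using that entry[of "p - 1" 0] assms[of "p - 1"] by (cases p) auto
  have "array_det ?n a = det (L * A)"
    using det_mult[OF carr] detL by (simp add: A_def)
  also have "\<dots> = (\<Sum>p<?n. (L * A) $$ (p, 0) * cofactor (L * A) p 0)"
    by (rule laplace_expansion_column[of _ ?n]) (use carr in auto)
  also have "\<dots> = (\<Sum>p\<in>{0}. (L * A) $$ (p, 0) * cofactor (L * A) p 0)"
    by (rule sum.mono_neutral_right) (use below in auto)
  also have "\<dots> = a 0 0 * det (mat_delete (L * A) 0 0)"
    using entry0[of 0] by (simp add: cofactor_def)
  also have "mat_delete (L * A) 0 0
      = mat k k (\<lambda>(p, q). a (Suc p) (Suc q) - (\<Sum>l\<le>p. c p l * a l (Suc q)))"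
    by (rule eq_matI) (use carr in \<open>auto simp: mat_delete_def entry simp del: index_mult_mat(1)\<close>)
  finally show ?thesis .
qed

lemma array_det_two: "array_det 2 a = a 0 0 * a 1 1 - a 0 1 * a 1 0"
proof -
  have "array_det 2 a = (\<Sum>p<2. mat 2 2 (\<lambda>(p, q). a p q) $$ (p, 0)
      * cofactor (mat 2 2 (\<lambda>(p, q). a p q)) p 0)"
    by (rule laplace_expansion_column) auto
  also have "\<dots> = a 0 0 * a 1 1 - a 0 1 * a 1 0"
    by (simp add: numeral_2_eq_2 cofactor_def mat_delete_def det_single)
  finally show ?thesis .
qed

section \<open>Symmetric matrices with non-negative principal minors\<close>

lemma sum_only_index:
  fixes h :: "'a \<Rightarrow> real"
  assumes "finite A" "l \<in> A" "\<And>m. m \<in> A \<Longrightarrow> m \<noteq> l \<Longrightarrow> h m = 0"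
  shows "sum h A = h l"
proof -
  have "sum h A = h l + sum h (A - {l})" by (rule sum.remove[OF assms(1,2)])
  also have "sum h (A - {l}) = 0" by (rule sum.neutral) (use assms(3) in auto)
  finally show ?thesis by simp
qed

lemma sum_single_index:
  fixes f :: "nat \<Rightarrow> real"
  assumes "r \<le> p"
  shows "(\<Sum>l\<le>p. (if l = r then x else 0) * f l) = x * f r"
  using sum_only_index[of "{..p}" r "\<lambda>l. (if l = r then x else 0) * f l"] assms by simp

text \<open>By induction on the size: if the corner entry is positive, completing the square splits off the
  Schur complement, whose principal minors are those principal minors of the matrix that use the first
  row and column, divided by the corner. If the corner vanishes, the 2-by-2 principal minors through it
  force the whole first row and column to vanish.\<close>

lemma quadratic_form_nonneg_of_principal_minors:
  fixes a :: "nat \<Rightarrow> nat \<Rightarrow> real"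
  assumes "\<And>p q. p < n \<Longrightarrow> q < n \<Longrightarrow> a p q = a q p"
    and "\<And>k i. strict_mono_on {..<k} i \<Longrightarrow> \<forall>p<k. i p < n \<Longrightarrow>
           array_det k (\<lambda>p q. a (i p) (i q)) \<ge> 0"
  shows "(\<Sum>p<n. \<Sum>q<n. v p * a p q * v q) \<ge> 0"
  using assms
proof (induction n arbitrary: a v)
  case 0
  then show ?case by simp
next
  case (Suc n)
  have sym: "a p q = a q p" if "p < Suc n" "q < Suc n" for p q
    using Suc.prems(1) that .
  have expand: "(\<Sum>p<Suc n. \<Sum>q<Suc n. v p * a p q * v q)
      = a 0 0 * (v 0)\<^sup>2 + 2 * v 0 * (\<Sum>q<n. a 0 (Suc q) * v (Suc q))
        + (\<Sum>p<n. \<Sum>q<n. v (Suc p) * a (Suc p) (Suc q) * v (Suc q))"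
  proof -
    have "(\<Sum>p<n. v (Suc p) * a (Suc p) 0 * v 0) = v 0 * (\<Sum>q<n. a 0 (Suc q) * v (Suc q))"
      unfolding sum_distrib_left by (rule sum.cong) (auto simp: sym)
    moreover have "(\<Sum>q<n. v 0 * a 0 (Suc q) * v (Suc q)) = v 0 * (\<Sum>q<n. a 0 (Suc q) * v (Suc q))"
      unfolding sum_distrib_left by (rule sum.cong) auto
    ultimately show ?thesis
      by (simp add: sum.lessThan_Suc_shift sum.distrib power2_eq_square algebra_simps
          del: sum.lessThan_Suc)
  qed
  have lift: "strict_mono_on {..<Suc k} (case_nat 0 (\<lambda>p. Suc (i p)))"
       "\<forall>q<Suc k. case_nat 0 (\<lambda>p. Suc (i p)) q < Suc n"
    if "strict_mono_on {..<k} i" "\<forall>p<k. i p < n" for k :: nat and i :: "nat \<Rightarrow> nat"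
    using that by (auto simp: strict_mono_on_def less_Suc_eq_0_disj split: nat.split)
  have a00: "a 0 0 \<ge> 0"
  proof -
    have "array_det 1 (\<lambda>p q. a ((\<lambda>_. 0) p) ((\<lambda>_. 0) q)) \<ge> 0"
      by (rule Suc.prems(2)) (auto simp: strict_mono_on_def)
    then show ?thesis by (simp add: det_single)
  qed
  show ?case
  proof (cases "a 0 0 = 0")
    case True
    have zero: "a 0 (Suc q) = 0" if "q < n" for q
    proof -
      \<comment> \<open>The minor on rows and columns \<open>0\<close> and \<open>Suc q\<close> equals minus the square of \<open>a 0 (Suc q)\<close>.\<close>
      have "array_det 2 (\<lambda>p r. a (case_nat 0 (\<lambda>_. Suc q) p) (case_nat 0 (\<lambda>_. Suc q) r)) \<ge> 0"
        by (rule Suc.prems(2))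
           (use that in \<open>auto simp: strict_mono_on_def numeral_2_eq_2 less_Suc_eq_0_disj\<close>)
      then have "(a 0 (Suc q))\<^sup>2 \<le> 0"
        using True sym[of "Suc q" 0] that by (simp add: array_det_two power2_eq_square)
      then show ?thesis by simp
    qed
    have "(\<Sum>p<n. \<Sum>q<n. v (Suc p) * a (Suc p) (Suc q) * v (Suc q)) \<ge> 0"
    proof (rule Suc.IH)
      show "a (Suc p) (Suc q) = a (Suc q) (Suc p)" if "p < n" "q < n" for p q
        using sym that by simp
      show "array_det k (\<lambda>p q. a (Suc (i p)) (Suc (i q))) \<ge> 0"
        if "strict_mono_on {..<k} i" "\<forall>p<k. i p < n" for k :: nat and i :: "nat \<Rightarrow> nat"
        by (rule Suc.prems(2)) (use that in \<open>auto simp: strict_mono_on_def\<close>)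
    qed
    then show ?thesis using expand True zero by simp
  next
    case False
    define b where "b p q = a (Suc p) (Suc q) - a (Suc p) 0 * a 0 (Suc q) / a 0 0" for p q
    have "(\<Sum>p<n. \<Sum>q<n. v (Suc p) * b p q * v (Suc q)) \<ge> 0"
    proof (rule Suc.IH)
      show "b p q = b q p" if "p < n" "q < n" for p q
        using sym that by (simp add: b_def)
    next
      fix k :: nat and i :: "nat \<Rightarrow> nat" assume i: "strict_mono_on {..<k} i" "\<forall>p<k. i p < n"
      let ?i = "case_nat 0 (\<lambda>p. Suc (i p))"
      have "0 \<le> array_det (Suc k) (\<lambda>p q. a (?i p) (?i q))"
        using Suc.prems(2)[OF lift[OF i]] .
      also have "\<dots> = a 0 0 * array_det k (\<lambda>p q. b (i p) (i q))"
        using False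
        by (subst array_det_eliminate_first_column[where c = "\<lambda>p l. if l = 0 then a (Suc (i p)) 0 / a 0 0 else 0"])
           (auto simp: b_def sum_single_index intro!: arg_cong2[where f = "(*)"] array_det_cong)
      finally show "array_det k (\<lambda>p q. b (i p) (i q)) \<ge> 0"
        using False a00 by (simp add: zero_le_mult_iff)
    qed
    moreover have "(\<Sum>p<n. \<Sum>q<n. v (Suc p) * b p q * v (Suc q))
        = (\<Sum>p<n. \<Sum>q<n. v (Suc p) * a (Suc p) (Suc q) * v (Suc q))
          - (\<Sum>q<n. a 0 (Suc q) * v (Suc q))\<^sup>2 / a 0 0"
    proof -
      have "(\<Sum>q<n. a 0 (Suc q) * v (Suc q))\<^sup>2 / a 0 0
          = (\<Sum>p<n. \<Sum>q<n. v (Suc p) * (a (Suc p) 0 * a 0 (Suc q) / a 0 0) * v (Suc q))"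
        unfolding power2_eq_square sum_product sum_divide_distrib
        by (intro sum.cong refl) (auto simp: sym)
      then show ?thesis
        by (simp add: b_def algebra_simps sum_subtractf)
    qed
    ultimately have "0 \<le> (\<Sum>p<n. \<Sum>q<n. v (Suc p) * a (Suc p) (Suc q) * v (Suc q))
          - (\<Sum>q<n. a 0 (Suc q) * v (Suc q))\<^sup>2 / a 0 0" by simp
    moreover have "0 \<le> a 0 0 * (v 0 + (\<Sum>q<n. a 0 (Suc q) * v (Suc q)) / a 0 0)\<^sup>2"
      using a00 by simp
    moreover have "a 0 0 * (v 0 + (\<Sum>q<n. a 0 (Suc q) * v (Suc q)) / a 0 0)\<^sup>2
      = a 0 0 * (v 0)\<^sup>2 + 2 * v 0 * (\<Sum>q<n. a 0 (Suc q) * v (Suc q))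
        + (\<Sum>q<n. a 0 (Suc q) * v (Suc q))\<^sup>2 / a 0 0"
      using False by (simp add: power2_eq_square field_simps)
    ultimately show ?thesis unfolding expand by linarith
  qed
qed

section \<open>Vandermonde products and Schur polynomials\<close>

lemma vandermonde_map: "vandermonde (map y [0..<k]) = (\<Prod>j<k. \<Prod>i<j. y j - y i)"
  by (auto simp: vandermonde_def intro!: prod.cong)

lemma vandermonde_Suc_shift:
  "vandermonde (map y [0..<Suc k])
   = (\<Prod>p<k. y (Suc p) - y 0) * vandermonde (map (\<lambda>p. y (Suc p)) [0..<k])"
  unfolding vandermonde_map
  by (simp add: prod.lessThan_Suc_shift prod.distrib del: prod.lessThan_Suc)

lemma vandermonde_snoc:
  "vandermonde (ts @ [t]) = vandermonde ts * (\<Prod>i<length ts. t - ts ! i)"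
  by (auto simp: vandermonde_def nth_append intro!: arg_cong2[where f = "(*)"] prod.cong)

text \<open>The discriminant of a finite family of reals: the square of its Vandermonde product, in a form
  that does not depend on an order of the index set. Squared Vandermonde products of rearranged
  tuples are compared through it.\<close>

definition discr :: "'a set \<Rightarrow> ('a \<Rightarrow> real) \<Rightarrow> real" where
  "discr A y = (\<Prod>a\<in>A. \<Prod>b\<in>A - {a}. \<bar>y a - y b\<bar>)"

lemma discr_nonneg: "discr A y \<ge> 0"
  by (simp add: discr_def prod_nonneg)

lemma discr_insert:
  assumes "finite A" "a \<notin> A"
  shows "discr (insert a A) y = discr A y * (\<Prod>b\<in>A. (y a - y b)\<^sup>2)"
proof -
  have "(\<Prod>b\<in>insert a A - {c}. \<bar>y c - y b\<bar>) = \<bar>y a - y c\<bar> * (\<Prod>b\<in>A - {c}. \<bar>y c - y b\<bar>)"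
    if "c \<in> A" for c
  proof -
    have "insert a A - {c} = insert a (A - {c})" using that assms by auto
    then show ?thesis using assms by (simp add: abs_minus_commute)
  qed
  then have "discr (insert a A) y
      = (\<Prod>b\<in>A. \<bar>y a - y b\<bar>) * (\<Prod>c\<in>A. \<bar>y a - y c\<bar> * (\<Prod>b\<in>A - {c}. \<bar>y c - y b\<bar>))"
    using assms by (simp add: discr_def)
  also have "\<dots> = discr A y * ((\<Prod>b\<in>A. \<bar>y a - y b\<bar>) * (\<Prod>b\<in>A. \<bar>y a - y b\<bar>))"
    by (simp add: discr_def prod.distrib)
  also have "(\<Prod>b\<in>A. \<bar>y a - y b\<bar>) * (\<Prod>b\<in>A. \<bar>y a - y b\<bar>) = (\<Prod>b\<in>A. (y a - y b)\<^sup>2)"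
    unfolding prod.distrib[symmetric] by (simp add: power2_eq_square)
  finally show ?thesis .
qed

lemma discr_cong: "(\<And>a. a \<in> A \<Longrightarrow> y a = z a) \<Longrightarrow> discr A y = discr A z"
  unfolding discr_def by (intro prod.cong) auto

lemma vandermonde_sq:
  "distinct xs \<Longrightarrow> (vandermonde (map y xs))\<^sup>2 = discr (set xs) y"
proof (induction xs rule: rev_induct)
  case Nil
  then show ?case by (simp add: vandermonde_def discr_def)
next
  case (snoc a xs)
  have "(\<Prod>i<length xs. y a - map y xs ! i) = (\<Prod>b\<leftarrow>xs. y a - y b)"
    by (simp add: prod.list_conv_set_nth atLeast0LessThan)
  also have "\<dots> = (\<Prod>b\<in>set xs. y a - y b)"
    using snoc.prems by (simp add: prod.distinct_set_conv_list)
  finally show ?case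
    using snoc by (simp add: vandermonde_snoc power_mult_distrib discr_insert prod_power_distrib)
qed

text \<open>The Schur polynomial in \<open>k\<close> variables attached to an increasing sequence \<open>i\<close> of \<open>k\<close> exponents,
  that is, to the partition with parts \<open>i q - q\<close>, given by the branching rule: the sum runs over the
  sequences \<open>m\<close> that interlace \<open>i\<close>, and the variable \<open>y 0\<close> is split off. All coefficients are visibly
  non-negative, and this is all that is used of Schur theory.\<close>

primrec schur :: "nat \<Rightarrow> (nat \<Rightarrow> nat) \<Rightarrow> (nat \<Rightarrow> real) \<Rightarrow> real" where
  "schur 0 i y = 1"
| "schur (Suc k) i y = y 0 ^ i 0 * (\<Sum>m\<in>PiE {..<k} (\<lambda>q. {i q..<i (Suc q)}).
     (\<Prod>q<k. y 0 ^ (i (Suc q) - 1 - m q)) * schur k m (\<lambda>p. y (Suc p)))"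

lemma power_gap_factor:
  fixes x y :: real
  assumes "a \<le> b"
  shows "x ^ b - y ^ (b - a) * x ^ a = (x - y) * (\<Sum>m=a..<b. y ^ (b - 1 - m) * x ^ m)"
  using assms
proof (induction b rule: dec_induct)
  case base
  then show ?case by simp
next
  case (step b)
  have "(\<Sum>m=a..<b. y ^ (b - m) * x ^ m) = y * (\<Sum>m=a..<b. y ^ (b - 1 - m) * x ^ m)"
    unfolding sum_distrib_left
  proof (rule sum.cong)
    fix m assume "m \<in> {a..<b}"
    then have "b - m = Suc (b - 1 - m)" by auto
    then show "y ^ (b - m) * x ^ m = y * (y ^ (b - 1 - m) * x ^ m)" by simp
  qed simp
  then have "(x - y) * (\<Sum>m=a..<Suc b. y ^ (Suc b - 1 - m) * x ^ m)
      = (x - y) * x ^ b + y * ((x - y) * (\<Sum>m=a..<b. y ^ (b - 1 - m) * x ^ m))"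
    using step.hyps by (simp add: algebra_simps)
  also have "\<dots> = (x - y) * x ^ b + y * (x ^ b - y ^ (b - a) * x ^ a)"
    by (simp only: step.IH)
  also have "\<dots> = x ^ Suc b - y ^ (Suc b - a) * x ^ a"
    using step.hyps by (simp add: Suc_diff_le algebra_simps)
  finally show ?case ..
qed

text \<open>Subtracting from each row the suitable multiple of the preceding one clears the column of \<open>y 0\<close>
  and leaves, in the column of \<open>y (Suc p)\<close>, the factor \<open>y (Suc p) - y 0\<close> times a sum over the gap
  between two consecutive exponents. Expanding these sums row by row gives the interlacing sequences
  of the branching rule.\<close>

lemma generalized_vandermonde:
  assumes "strict_mono_on {..<k} i"
  shows "array_det k (\<lambda>q p. y p ^ i q) = vandermonde (map y [0..<k]) * schur k i y"
  using assms
proof (induction k arbitrary: i y)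
  case 0
  then show ?case by (simp add: vandermonde_def)
next
  case (Suc k)
  let ?S = "\<lambda>q. {i q..<i (Suc q)}" and ?y = "\<lambda>p. y (Suc p)"
  have less: "i q < i (Suc q)" if "q < k" for q
    using Suc.prems that by (auto simp: strict_mono_on_def)
  have mono: "strict_mono_on {..<k} m" if "m \<in> PiE {..<k} ?S" for m
  proof (rule strict_mono_onI)
    fix p q assume pq: "p \<in> {..<k}" "q \<in> {..<k}" "p < q"
    have "m p \<in> ?S p" "m q \<in> ?S q" using PiE_mem[OF that] pq(1,2) by blast+
    then have "m p < i (Suc p)" "i q \<le> m q" by auto
    moreover have "i (Suc p) \<le> i q"
      using Suc.prems pq by (intro strict_mono_on_leD[OF Suc.prems]) auto
    ultimately show "m p < m q" by linarith
  qed
  have gap: "y 0 ^ i (Suc q) = y 0 ^ (i (Suc q) - i q) * y 0 ^ i q" if "q < k" for q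
    using less[OF that] by (simp flip: power_add)
  have "array_det (Suc k) (\<lambda>q p. y p ^ i q)
      = y 0 ^ i 0 * array_det k (\<lambda>q p. y (Suc p) ^ i (Suc q)
          - (\<Sum>l\<le>q. (if l = q then y 0 ^ (i (Suc q) - i q) else 0) * y (Suc p) ^ i l))"
  proof (rule array_det_eliminate_first_column[where
        c = "\<lambda>q l. if l = q then y 0 ^ (i (Suc q) - i q) else 0"])
    show "y 0 ^ i (Suc q)
        = (\<Sum>l\<le>q. (if l = q then y 0 ^ (i (Suc q) - i q) else 0) * y 0 ^ i l)" if "q < k" for q
      unfolding sum_single_index[OF order_refl] by (rule gap[OF that])
  qed
  also have "array_det k (\<lambda>q p. y (Suc p) ^ i (Suc q)
          - (\<Sum>l\<le>q. (if l = q then y 0 ^ (i (Suc q) - i q) else 0) * y (Suc p) ^ i l))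
      = array_det k (\<lambda>q p. (y (Suc p) - y 0)
          * (\<Sum>m\<in>?S q. y 0 ^ (i (Suc q) - 1 - m) * y (Suc p) ^ m))"
  proof (rule array_det_cong)
    fix q p assume "q < k"
    show "y (Suc p) ^ i (Suc q)
          - (\<Sum>l\<le>q. (if l = q then y 0 ^ (i (Suc q) - i q) else 0) * y (Suc p) ^ i l)
        = (y (Suc p) - y 0) * (\<Sum>m\<in>?S q. y 0 ^ (i (Suc q) - 1 - m) * y (Suc p) ^ m)"
      using power_gap_factor[of "i q" "i (Suc q)" "y (Suc p)" "y 0"] less[OF \<open>q < k\<close>]
      by (simp add: sum_single_index)
  qed
  also have "\<dots> = (\<Prod>p<k. y (Suc p) - y 0)
      * array_det k (\<lambda>q p. \<Sum>m\<in>?S q. y 0 ^ (i (Suc q) - 1 - m) * y (Suc p) ^ m)"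
    by (rule array_det_scale_cols)
  also have "array_det k (\<lambda>q p. \<Sum>m\<in>?S q. y 0 ^ (i (Suc q) - 1 - m) * y (Suc p) ^ m)
      = (\<Sum>m\<in>PiE {..<k} ?S. array_det k (\<lambda>q p. y 0 ^ (i (Suc q) - 1 - m q) * y (Suc p) ^ m q))"
    by (rule array_det_sum_rows) simp
  also have "\<dots> = (\<Sum>m\<in>PiE {..<k} ?S. (\<Prod>q<k. y 0 ^ (i (Suc q) - 1 - m q))
      * (vandermonde (map ?y [0..<k]) * schur k m ?y))"
    by (intro sum.cong refl) (simp only: array_det_scale_rows Suc.IH[OF mono])
  finally show ?case
    by (simp add: vandermonde_Suc_shift sum_distrib_left mult_ac del: upt_Suc)
qed

lemma schur_mono:
  assumes "\<And>p. p < k \<Longrightarrow> 0 \<le> x p" "\<And>p. p < k \<Longrightarrow> x p \<le> y p"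
  shows "0 \<le> schur k i x \<and> schur k i x \<le> schur k i y"
  using assms
proof (induction k arbitrary: i x y)
  case 0
  then show ?case by simp
next
  case (Suc k)
  have IH: "0 \<le> schur k m (\<lambda>p. x (Suc p))" "schur k m (\<lambda>p. x (Suc p)) \<le> schur k m (\<lambda>p. y (Suc p))" for m
    using Suc.IH[of "\<lambda>p. x (Suc p)" "\<lambda>p. y (Suc p)" m] Suc.prems by auto
  have 0: "0 \<le> x 0" "x 0 \<le> y 0" "0 \<le> y 0" using Suc.prems[of 0] by auto
  show ?case
    unfolding schur.simps
    by (intro conjI mult_nonneg_nonneg mult_mono sum_nonneg sum_mono prod_nonneg prod_mono
        power_mono zero_le_power IH 0)
qed

section \<open>Minors of moment matrices\<close>

text \<open>Andreief's identity, a discrete form of Cauchy and Binet. The sum runs over all maps instead of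
  subsets; the factor \<open>k!\<close> counts the orders in which a set of nodes is met. It arises by
  averaging the multilinear expansion in the rows over all permutations of the positions.\<close>

lemma andreief:
  fixes F G :: "nat \<Rightarrow> 'm \<Rightarrow> real"
  assumes "finite A"
  shows "fact k * array_det k (\<lambda>p q. \<Sum>m\<in>A. w m * F p m * G q m)
       = (\<Sum>\<phi>\<in>PiE {..<k} (\<lambda>_. A). (\<Prod>p<k. w (\<phi> p))
            * array_det k (\<lambda>p q. F p (\<phi> q)) * array_det k (\<lambda>p q. G p (\<phi> q)))"
proof -
  let ?\<Phi> = "PiE {..<k} (\<lambda>_. A)"
  let ?G = "\<lambda>\<phi>. array_det k (\<lambda>p q. G q (\<phi> p))"
  have expand: "array_det k (\<lambda>p q. \<Sum>m\<in>A. w m * F p m * G q m)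
      = (\<Sum>\<phi>\<in>?\<Phi>. (\<Prod>p<k. w (\<phi> p)) * (\<Prod>p<k. F p (\<phi> p)) * ?G \<phi>)"
    using assms by (subst array_det_sum_rows) (auto simp: array_det_scale_rows prod.distrib)
  have reindex: "(\<Sum>\<phi>\<in>?\<Phi>. (\<Prod>p<k. w (\<phi> p)) * (\<Prod>p<k. F p (\<phi> p)) * ?G \<phi>)
      = (\<Sum>\<phi>\<in>?\<Phi>. (\<Prod>p<k. w (\<phi> p)) * (signof \<sigma> * (\<Prod>p<k. F p (\<phi> (\<sigma> p)))) * ?G \<phi>)"
    if \<sigma>: "\<sigma> permutes {..<k}" for \<sigma>
  proof -
    have closed: "\<phi> \<circ> \<tau> \<in> ?\<Phi>" if "\<phi> \<in> ?\<Phi>" "\<tau> permutes {..<k}" for \<phi> \<tau>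
      using that permutes_in_image[OF that(2)] permutes_not_in[OF that(2)]
      by (auto simp: PiE_def extensional_def Pi_def)
    have "(\<Sum>\<phi>\<in>?\<Phi>. (\<Prod>p<k. w (\<phi> p)) * (\<Prod>p<k. F p (\<phi> p)) * ?G \<phi>)
        = (\<Sum>\<phi>\<in>?\<Phi>. (\<Prod>p<k. w ((\<phi> \<circ> \<sigma>) p)) * (\<Prod>p<k. F p ((\<phi> \<circ> \<sigma>) p)) * ?G (\<phi> \<circ> \<sigma>))"
      by (rule sum.reindex_bij_witness[of _ "\<lambda>\<phi>. \<phi> \<circ> \<sigma>" "\<lambda>\<phi>. \<phi> \<circ> inv_into UNIV \<sigma>"])
         (use \<sigma> permutes_inv[OF \<sigma>] in \<open>simp_all add: closed comp_assoc permutes_inv_o\<close>)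
    also have "\<dots> = (\<Sum>\<phi>\<in>?\<Phi>. (\<Prod>p<k. w (\<phi> p)) * (signof \<sigma> * (\<Prod>p<k. F p (\<phi> (\<sigma> p)))) * ?G \<phi>)"
    proof (rule sum.cong[OF refl])
      fix \<phi>
      have "(\<Prod>p<k. w ((\<phi> \<circ> \<sigma>) p)) = (\<Prod>p<k. w (\<phi> p))"
        using prod.permute[OF \<sigma>, of "\<lambda>p. w (\<phi> p)"] by (simp add: comp_def)
      moreover have "?G (\<phi> \<circ> \<sigma>) = signof \<sigma> * ?G \<phi>"
        using array_det_permute_rows[OF \<sigma>, of "\<lambda>p q. G q (\<phi> p)"] by simp
      ultimately show "(\<Prod>p<k. w ((\<phi> \<circ> \<sigma>) p)) * (\<Prod>p<k. F p ((\<phi> \<circ> \<sigma>) p)) * ?G (\<phi> \<circ> \<sigma>)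
          = (\<Prod>p<k. w (\<phi> p)) * (signof \<sigma> * (\<Prod>p<k. F p (\<phi> (\<sigma> p)))) * ?G \<phi>"
        by (simp add: mult_ac)
    qed
    finally show ?thesis .
  qed
  have "fact k * array_det k (\<lambda>p q. \<Sum>m\<in>A. w m * F p m * G q m)
      = (\<Sum>\<sigma> | \<sigma> permutes {..<k}. array_det k (\<lambda>p q. \<Sum>m\<in>A. w m * F p m * G q m))"
    by (simp add: card_permutations)
  also have "\<dots> = (\<Sum>\<sigma> | \<sigma> permutes {..<k}. \<Sum>\<phi>\<in>?\<Phi>.
      (\<Prod>p<k. w (\<phi> p)) * (signof \<sigma> * (\<Prod>p<k. F p (\<phi> (\<sigma> p)))) * ?G \<phi>)"
    unfolding expand by (rule sum.cong[OF refl]) (rule reindex, simp)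
  also have "\<dots> = (\<Sum>\<phi>\<in>?\<Phi>. \<Sum>\<sigma> | \<sigma> permutes {..<k}.
      (\<Prod>p<k. w (\<phi> p)) * (signof \<sigma> * (\<Prod>p<k. F p (\<phi> (\<sigma> p)))) * ?G \<phi>)"
    by (rule sum.swap)
  also have "\<dots> = (\<Sum>\<phi>\<in>?\<Phi>. (\<Prod>p<k. w (\<phi> p)) * array_det k (\<lambda>p q. F p (\<phi> q)) * ?G \<phi>)"
    unfolding array_det_leibniz[of k "\<lambda>p q. F p (_ q)"]
    by (simp only: sum_distrib_left sum_distrib_right)
  also have "\<dots> = (\<Sum>\<phi>\<in>?\<Phi>. (\<Prod>p<k. w (\<phi> p))
            * array_det k (\<lambda>p q. F p (\<phi> q)) * array_det k (\<lambda>p q. G p (\<phi> q)))"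
    by (intro sum.cong refl arg_cong2[where f = "(*)"] array_det_transpose)
  finally show ?thesis .
qed

text \<open>For increasing \<open>i\<close> and \<open>j\<close> this is the product of two generalized Vandermonde determinants at the
  same nodes \<open>y\<close>. Only the Vandermonde products carry signs, and they combine to a square.\<close>

definition minor_weight :: "nat \<Rightarrow> (nat \<Rightarrow> nat) \<Rightarrow> (nat \<Rightarrow> nat) \<Rightarrow> (nat \<Rightarrow> real) \<Rightarrow> real" where
  "minor_weight k i j y = discr {..<k} y * schur k i y * schur k j y"

corollary exponential_sum_minor:
  fixes w y :: "'m \<Rightarrow> real"
  assumes "finite A" "strict_mono_on {..<k} i" "strict_mono_on {..<k} j"
  shows "fact k * array_det k (\<lambda>p q. \<Sum>m\<in>A. w m * y m ^ (i p + j q))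
       = (\<Sum>\<phi>\<in>PiE {..<k} (\<lambda>_. A). (\<Prod>p<k. w (\<phi> p)) * minor_weight k i j (y \<circ> \<phi>))"
proof -
  have "fact k * array_det k (\<lambda>p q. \<Sum>m\<in>A. w m * y m ^ (i p + j q))
      = fact k * array_det k (\<lambda>p q. \<Sum>m\<in>A. w m * y m ^ i p * y m ^ j q)"
    by (simp add: power_add mult_ac)
  also have "\<dots> = (\<Sum>\<phi>\<in>PiE {..<k} (\<lambda>_. A). (\<Prod>p<k. w (\<phi> p))
      * array_det k (\<lambda>p q. (y \<circ> \<phi>) q ^ i p) * array_det k (\<lambda>p q. (y \<circ> \<phi>) q ^ j p))"
    using andreief[OF assms(1), where F = "\<lambda>p m. y m ^ i p" and G = "\<lambda>p m. y m ^ j p"] by simp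
  also have "\<dots> = (\<Sum>\<phi>\<in>PiE {..<k} (\<lambda>_. A). (\<Prod>p<k. w (\<phi> p)) * minor_weight k i j (y \<circ> \<phi>))"
  proof (rule sum.cong[OF refl])
    fix \<phi>
    have sq: "(vandermonde (map (y \<circ> \<phi>) [0..<k]))\<^sup>2 = discr {..<k} (y \<circ> \<phi>)"
      using vandermonde_sq[of "[0..<k]" "y \<circ> \<phi>"] by (simp add: atLeast0LessThan)
    show "(\<Prod>p<k. w (\<phi> p)) * array_det k (\<lambda>p q. (y \<circ> \<phi>) q ^ i p) * array_det k (\<lambda>p q. (y \<circ> \<phi>) q ^ j p)
        = (\<Prod>p<k. w (\<phi> p)) * minor_weight k i j (y \<circ> \<phi>)"
      unfolding minor_weight_def generalized_vandermonde[OF assms(2)] generalized_vandermonde[OF assms(3)]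
        sq[symmetric] power2_eq_square
      by (simp only: mult_ac)
  qed
  finally show ?thesis .
qed

section \<open>Exchanging the top node\<close>

lemma discr_pos:
  assumes "finite A" "inj_on y A"
  shows "discr A y > 0"
  using assms by (auto simp: discr_def inj_on_def intro!: prod_pos)

lemma discr_not_inj:
  assumes "finite A" "\<not> inj_on y A"
  shows "discr A y = 0"
proof -
  obtain a b where "a \<in> A" "b \<in> A" "a \<noteq> b" "y a = y b"
    using assms(2) by (auto simp: inj_on_def)
  then have "(\<Prod>b\<in>A - {a}. \<bar>y a - y b\<bar>) = 0" using assms(1) by (auto intro!: prod_zero)
  then show ?thesis
    unfolding discr_def using \<open>a \<in> A\<close> assms(1) by (auto intro!: prod_zero)
qed

text \<open>The quotient of squared Vandermonde products in the constant \<open>C\<close>: all factors that do not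
  involve the exchanged entry cancel. It is also the square of the Lagrange coefficient of \<open>e j\<close>, among
  the first \<open>N\<close> exponents, for evaluation at \<open>e N\<close>.\<close>

definition node_ratio :: "nat \<Rightarrow> (nat \<Rightarrow> real) \<Rightarrow> nat \<Rightarrow> real" where
  "node_ratio N e j = (\<Prod>l\<in>{..<N} - {j}. ((e N - e l) / (e j - e l))\<^sup>2)"

lemma vandermonde_sq_ratio:
  assumes e: "inj_on e {..N}" and j: "j < N"
  shows "(vandermonde (map e ([0..<j] @ [Suc j..<N]) @ [e N]))\<^sup>2 / (vandermonde (map e [0..<N]))\<^sup>2
       = node_ratio N e j"
proof -
  let ?B = "{..<N} - {j}"
  have setl: "set (([0..<j] @ [Suc j..<N]) @ [N]) = insert N ?B"
    using j by auto
  have "(vandermonde (map e ([0..<j] @ [Suc j..<N]) @ [e N]))\<^sup>2 = discr (insert N ?B) e"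
    using vandermonde_sq[of "([0..<j] @ [Suc j..<N]) @ [N]" e] j unfolding setl by auto
  also have "\<dots> = discr ?B e * (\<Prod>l\<in>?B. (e N - e l)\<^sup>2)"
    by (rule discr_insert) auto
  finally have num: "(vandermonde (map e ([0..<j] @ [Suc j..<N]) @ [e N]))\<^sup>2
    = discr ?B e * (\<Prod>l\<in>?B. (e N - e l)\<^sup>2)" .
  have "(vandermonde (map e [0..<N]))\<^sup>2 = discr (insert j ?B) e"
    using vandermonde_sq[of "[0..<N]" e] j by (simp add: insert_absorb atLeast0LessThan)
  also have "\<dots> = discr ?B e * (\<Prod>l\<in>?B. (e j - e l)\<^sup>2)"
    by (rule discr_insert) auto
  finally have den: "(vandermonde (map e [0..<N]))\<^sup>2 = discr ?B e * (\<Prod>l\<in>?B. (e j - e l)\<^sup>2)" .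
  have "inj_on e ?B" by (rule inj_on_subset[OF e]) auto
  then have "discr ?B e \<noteq> 0" using discr_pos[of ?B e] by simp
  then show ?thesis
    unfolding num den node_ratio_def by (simp add: power_divide prod_dividef)
qed

text \<open>Convexity of \<open>t \<mapsto> r powr t\<close>, from its tangent at the middle point.\<close>

lemma powr_three_points:
  fixes r :: real
  assumes "0 < r" "a \<le> b" "b \<le> c"
  shows "(c - a) * r powr b \<le> (c - b) * r powr a + (b - a) * r powr c"
proof -
  have tangent: "r powr t \<ge> r powr b * (1 + (t - b) * ln r)" for t
  proof -
    have "r powr t = r powr b * r powr (t - b)" by (simp flip: powr_add)
    also have "r powr (t - b) = exp ((t - b) * ln r)" using assms by (simp add: powr_def)
    also have "r powr b * exp ((t - b) * ln r) \<ge> r powr b * (1 + (t - b) * ln r)"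
      by (rule mult_left_mono[OF exp_ge_add_one_self]) simp
    finally show ?thesis .
  qed
  have "(c - b) * (r powr b * (1 + (a - b) * ln r)) \<le> (c - b) * r powr a"
    using tangent[of a] assms by (intro mult_left_mono) auto
  moreover have "(b - a) * (r powr b * (1 + (c - b) * ln r)) \<le> (b - a) * r powr c"
    using tangent[of c] assms by (intro mult_left_mono) auto
  moreover have "(c - b) * (r powr b * (1 + (a - b) * ln r)) + (b - a) * (r powr b * (1 + (c - b) * ln r))
      = (c - a) * r powr b" by (simp add: algebra_simps)
  ultimately show ?thesis by linarith
qed

text \<open>For \<open>r \<le> 1\<close> the function \<open>t \<mapsto> r powr t\<close> is convex and decreasing, so the absolute slope of
  its chord from \<open>a\<close> shrinks when the other end point moves to the right, from \<open>b\<close> to \<open>M\<close>. The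
  inequality is multiplied out, which admits \<open>a = b\<close> and \<open>r = 1\<close>.\<close>

lemma powr_slope_decreasing:
  fixes r :: real
  assumes r: "0 < r" "r \<le> 1" and "a < M" "b < M"
  shows "\<bar>r powr M - r powr a\<bar> * \<bar>b - a\<bar> \<le> \<bar>M - a\<bar> * \<bar>r powr b - r powr a\<bar>"
proof -
  have anti: "r powr t \<le> r powr s" if "s \<le> t" for s t
    using powr_mono'[OF that] r by auto
  show ?thesis
  proof (cases "a \<le> b")
    case True
    then show ?thesis
      using powr_three_points[of r a b M] anti[of a M] anti[of a b] assms
      by (simp add: algebra_simps)
  next
    case False
    then show ?thesis
      using powr_three_points[of r b a M] anti[of a M] anti[of b a] assms
      by (simp add: algebra_simps)
  qed
qed

text \<open>The chord comparison bounds the factor at each node of \<open>L\<close> by the corresponding factor of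
  \<open>node_ratio\<close>. The other factors of \<open>node_ratio\<close> belong to nodes below \<open>j\<close>, because \<open>L\<close> contains
  everything between \<open>j\<close> and \<open>N\<close>, and those factors are at least \<open>1\<close>.\<close>

lemma prod_slopes_le:
  assumes e: "strict_mono_on {..N} e" and r: "0 < r" "r \<le> (1::real)"
    and L: "L \<subseteq> {..<N}" and j: "j < N" "j \<notin> L"
    and top: "\<And>l. l < N \<Longrightarrow> j < l \<Longrightarrow> l \<in> L"
  shows "(\<Prod>l\<in>L. (r powr e N - r powr e l)\<^sup>2)
    \<le> node_ratio N e j * (\<Prod>l\<in>L. (r powr e j - r powr e l)\<^sup>2)"
proof -
  let ?q = "\<lambda>l. ((e N - e l) / (e j - e l))\<^sup>2"
  have fin: "finite L" using L finite_subset by blast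
  have lt: "e l < e m" if "l < m" "m \<le> N" for l m
    using e that by (auto simp: strict_mono_on_def)
  have "(\<Prod>l\<in>L. (r powr e N - r powr e l)\<^sup>2) \<le> (\<Prod>l\<in>L. ?q l * (r powr e j - r powr e l)\<^sup>2)"
  proof (rule prod_mono, intro conjI)
    fix l assume l: "l \<in> L"
    then have "l < N" "l \<noteq> j" using L j by auto
    then have ne: "e j \<noteq> e l" using lt[of l j] lt[of j l] j by (cases "l < j") auto
    have "\<bar>r powr e N - r powr e l\<bar> * \<bar>e j - e l\<bar> \<le> \<bar>e N - e l\<bar> * \<bar>r powr e j - r powr e l\<bar>"
      by (rule powr_slope_decreasing) (use r lt \<open>l < N\<close> j in auto)
    then have "\<bar>r powr e N - r powr e l\<bar> \<le> \<bar>(e N - e l) / (e j - e l) * (r powr e j - r powr e l)\<bar>"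
      unfolding abs_mult abs_divide times_divide_eq_left
      by (subst pos_le_divide_eq) (use ne in simp_all)
    then show "(r powr e N - r powr e l)\<^sup>2 \<le> ?q l * (r powr e j - r powr e l)\<^sup>2"
      unfolding power_mult_distrib[symmetric] by (rule abs_le_square_iff[THEN iffD1])
  qed simp
  also have "\<dots> = (\<Prod>l\<in>L. ?q l) * (\<Prod>l\<in>L. (r powr e j - r powr e l)\<^sup>2)"
    by (rule prod.distrib)
  also have "\<dots> \<le> node_ratio N e j * (\<Prod>l\<in>L. (r powr e j - r powr e l)\<^sup>2)"
  proof (rule mult_right_mono)
    have "1 \<le> (\<Prod>l\<in>{..<N} - {j} - L. ?q l)"
    proof (rule prod_ge_1)
      fix l assume l: "l \<in> {..<N} - {j} - L"
      then have "l < j" using top[of l] by (metis DiffD1 DiffD2 lessThan_iff linorder_neqE_nat singletonI)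
      then have "e l < e j" "e j < e N" using lt j by auto
      then have "1 \<le> (e N - e l) / (e j - e l)" by (simp add: field_simps)
      then show "1 \<le> ?q l" by (simp add: one_le_power)
    qed
    moreover have "node_ratio N e j = (\<Prod>l\<in>{..<N} - {j} - L. ?q l) * (\<Prod>l\<in>L. ?q l)"
      unfolding node_ratio_def by (rule prod.subset_diff) (use L j in auto)
    moreover have "0 \<le> (\<Prod>l\<in>L. ?q l)" by (rule prod_nonneg) simp
    ultimately show "(\<Prod>l\<in>L. ?q l) \<le> node_ratio N e j"
      using mult_right_mono[of 1 "\<Prod>l\<in>{..<N} - {j} - L. ?q l" "\<Prod>l\<in>L. ?q l"] by simp
  qed (simp add: prod_nonneg)
  finally show ?thesis .
qed

lemma node_ratio_nonneg: "node_ratio N e j \<ge> 0"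
  unfolding node_ratio_def by (rule prod_nonneg) simp

lemma minor_weight_nonneg:
  assumes "\<And>p. p < k \<Longrightarrow> 0 \<le> y p"
  shows "0 \<le> minor_weight k i j y"
  unfolding minor_weight_def
  using schur_mono[of k y y] assms by (simp add: discr_nonneg)

text \<open>Replacing the top node \<open>N\<close> by the largest unused node \<open>l\<close> costs at most the factor \<open>node_ratio\<close>:
  the discriminant changes only in the factors at position \<open>p0\<close>, and the Schur polynomials increase
  because \<open>r powr e N \<le> r powr e l\<close> when \<open>r \<le> 1\<close>.\<close>

lemma minor_weight_exchange:
  assumes e: "strict_mono_on {..N} e" and r: "0 < r" "r \<le> (1::real)"
    and \<phi>: "inj_on \<phi> {..<k}" "p0 < k" "\<phi> p0 = N" "\<phi> ` ({..<k} - {p0}) \<subseteq> {..<N}"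
    and l: "l < N" "l \<notin> \<phi> ` ({..<k} - {p0})"
    and top: "\<And>m. m < N \<Longrightarrow> l < m \<Longrightarrow> m \<in> \<phi> ` ({..<k} - {p0})"
  defines "y \<equiv> \<lambda>m. r powr e m"
  shows "minor_weight k i j (y \<circ> \<phi>) \<le> node_ratio N e l * minor_weight k i j (y \<circ> \<phi>(p0 := l))"
proof -
  let ?K = "{..<k} - {p0}" and ?\<psi> = "\<phi>(p0 := l)"
  let ?P = "\<lambda>m. \<Prod>p\<in>?K. (y m - y (\<phi> p))\<^sup>2"
  have K: "{..<k} = insert p0 ?K" using \<phi>(2) by auto
  have split: "discr {..<k} z = discr ?K z * (\<Prod>p\<in>?K. (z p0 - z p)\<^sup>2)" for z
    using discr_insert[of ?K p0 z] K by simp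
  have "discr {..<k} (y \<circ> \<phi>) = discr ?K (y \<circ> \<phi>) * ?P N"
    unfolding split by (simp add: \<phi>(3))
  moreover have "discr {..<k} (y \<circ> ?\<psi>) = discr ?K (y \<circ> \<phi>) * ?P l"
    unfolding split
    by (intro arg_cong2[where f = "(*)"] discr_cong prod.cong) auto
  moreover have "?P N \<le> node_ratio N e l * ?P l"
  proof -
    have inj: "inj_on \<phi> ?K" by (rule inj_on_subset[OF \<phi>(1)]) auto
    have "?P m = (\<Prod>l'\<in>\<phi> ` ?K. (y m - y l')\<^sup>2)" for m
      by (simp add: prod.reindex[OF inj])
    then show ?thesis
      using prod_slopes_le[OF e r \<phi>(4) l top] by (simp add: y_def)
  qed
  ultimately have "discr {..<k} (y \<circ> \<phi>) \<le> node_ratio N e l * discr {..<k} (y \<circ> ?\<psi>)"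
    using mult_left_mono[OF _ discr_nonneg[of ?K "y \<circ> \<phi>"], of "?P N" "node_ratio N e l * ?P l"]
    by (simp add: mult_ac)
  moreover have "0 \<le> schur k i' (y \<circ> \<phi>) \<and> schur k i' (y \<circ> \<phi>) \<le> schur k i' (y \<circ> ?\<psi>)" for i'
  proof (rule schur_mono)
    have "e l \<le> e N" using e l(1) by (auto simp: strict_mono_on_def intro: less_imp_le)
    then have "y N \<le> y l" unfolding y_def using powr_mono'[of "e l" "e N" r] r by auto
    then show "(y \<circ> \<phi>) p \<le> (y \<circ> ?\<psi>) p" for p using \<phi>(3) by simp
  qed (simp add: y_def)
  ultimately have "discr {..<k} (y \<circ> \<phi>) * schur k i (y \<circ> \<phi>) * schur k j (y \<circ> \<phi>)
      \<le> (node_ratio N e l * discr {..<k} (y \<circ> ?\<psi>)) * schur k i (y \<circ> ?\<psi>) * schur k j (y \<circ> ?\<psi>)"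
    by (intro mult_mono mult_nonneg_nonneg discr_nonneg node_ratio_nonneg)
       (blast intro: order_trans mult_nonneg_nonneg discr_nonneg node_ratio_nonneg)+
  then show ?thesis by (simp add: minor_weight_def mult_ac)
qed

section \<open>Non-negative minors from the coefficient condition\<close>

definition threshold :: "nat \<Rightarrow> (nat \<Rightarrow> real) \<Rightarrow> (nat \<Rightarrow> real) \<Rightarrow> real \<Rightarrow> real" where
  "threshold N e g \<rho> = (\<Sum>l<N. node_ratio N e l * (\<rho> powr (e N - e l) / g l))"

lemma minor_nonneg_nonneg_coeffs:
  fixes w y :: "nat \<Rightarrow> real"
  assumes "strict_mono_on {..<k} i" "strict_mono_on {..<k} j"
    and "\<And>m. m \<le> N \<Longrightarrow> 0 \<le> w m" "\<And>m. m \<le> N \<Longrightarrow> 0 \<le> y m"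
  shows "0 \<le> array_det k (\<lambda>p q. \<Sum>m\<le>N. w m * y m ^ (i p + j q))"
proof -
  have "0 \<le> fact k * array_det k (\<lambda>p q. \<Sum>m\<le>N. w m * y m ^ (i p + j q))"
    unfolding exponential_sum_minor[OF finite_atMost assms(1,2)]
  proof (intro sum_nonneg mult_nonneg_nonneg prod_nonneg minor_weight_nonneg)
    fix \<phi> assume \<phi>: "\<phi> \<in> PiE {..<k} (\<lambda>_. {..N})"
    show "0 \<le> (y \<circ> \<phi>) p" if "p < k" for p using assms(4) PiE_mem[OF \<phi>, of p] that by simp
    show "0 \<le> w (\<phi> p)" if "p \<in> {..<k}" for p using assms(3) PiE_mem[OF \<phi>, of p] that by simp
  qed
  then show ?thesis by (intro mult_left_le_imp_le[of "fact k" 0]) simp_all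
qed

text \<open>Each negative term of Andreief's sum is charged to a positive one by exchanging the top node. A
  positive term \<open>\<psi>\<close> can be charged once for every node \<open>l\<close>, since \<open>\<phi>\<close> is recovered from
  \<open>(l, \<psi>)\<close> by turning \<open>l\<close> back into \<open>N\<close>; the charges \<open>\<kappa> l\<close> add up to \<open>- g N\<close> times the threshold,
  hence to at most \<open>1\<close>.\<close>

lemma minor_nonneg_neg_coeff_contracting:
  assumes e: "strict_mono_on {..N} e"
    and g: "\<And>l. l < N \<Longrightarrow> 0 < g l" "g N < 0" "- g N * threshold N e g \<rho> \<le> 1"
    and a: "0 < a" "a \<le> \<rho>" and r: "0 < r" "r \<le> 1"
    and ij: "strict_mono_on {..<k} i" "strict_mono_on {..<k} j" and k: "k \<le> N"
  shows "0 \<le> array_det k (\<lambda>p q. \<Sum>m\<le>N. (g m * a powr e m) * (r powr e m) ^ (i p + j q))"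
proof -
  define y where "y = (\<lambda>m. r powr e m)"
  define w where "w = (\<lambda>m. g m * a powr e m)"
  define T where "T \<phi> = (\<Prod>p<k. w (\<phi> p)) * minor_weight k i j (y \<circ> \<phi>)" for \<phi>
  define \<Phi> where "\<Phi> = PiE {..<k} (\<lambda>_. {..N})"
  define \<Phi>0 where "\<Phi>0 = PiE {..<k} (\<lambda>_. {..<N})"
  define \<Phi>1 where "\<Phi>1 = {\<phi> \<in> \<Phi>. inj_on \<phi> {..<k} \<and> N \<in> \<phi> ` {..<k}}"
  have fin: "finite \<Phi>" "finite \<Phi>0" "finite \<Phi>1"
    unfolding \<Phi>_def \<Phi>0_def \<Phi>1_def by (simp_all add: finite_PiE)
  have y_inj: "inj_on (y \<circ> \<phi>) {..<k} \<Longrightarrow> inj_on \<phi> {..<k}" for \<phi>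
    by (rule inj_on_imageI2)
  have sub: "\<Phi>0 \<union> \<Phi>1 \<subseteq> \<Phi>"
    by (auto simp: \<Phi>_def \<Phi>0_def \<Phi>1_def PiE_def Pi_def intro: less_imp_le)
  have "sum T \<Phi> = sum T (\<Phi>0 \<union> \<Phi>1)"
  proof (rule sum.mono_neutral_right[OF fin(1) sub], rule ballI)
    fix \<phi> assume \<phi>: "\<phi> \<in> \<Phi> - (\<Phi>0 \<union> \<Phi>1)"
    have "N \<in> \<phi> ` {..<k}"
    proof (rule ccontr)
      assume N: "N \<notin> \<phi> ` {..<k}"
      have "\<phi> p < N" if "p < k" for p
      proof -
        have "\<phi> p \<le> N" using \<phi> that by (auto simp: \<Phi>_def)
        moreover have "\<phi> p \<noteq> N" using N that by blast
        ultimately show ?thesis by simp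
      qed
      then have "\<phi> \<in> \<Phi>0" using \<phi> by (auto simp: \<Phi>_def \<Phi>0_def PiE_def)
      then show False using \<phi> by simp
    qed
    then have "\<not> inj_on \<phi> {..<k}" using \<phi> by (auto simp: \<Phi>1_def)
    then have "discr {..<k} (y \<circ> \<phi>) = 0" using discr_not_inj y_inj by blast
    then show "T \<phi> = 0" by (simp add: T_def minor_weight_def)
  qed
  also have "\<dots> = sum T \<Phi>0 + sum T \<Phi>1"
  proof (rule sum.union_disjoint)
    show "\<Phi>0 \<inter> \<Phi>1 = {}" by (fastforce simp: \<Phi>0_def \<Phi>1_def)
  qed (use fin in auto)
  finally have decomp: "sum T \<Phi> = sum T \<Phi>0 + sum T \<Phi>1" .
  have T0: "0 \<le> T \<phi>" if "\<phi> \<in> \<Phi>0" for \<phi>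
    unfolding T_def
  proof (intro mult_nonneg_nonneg prod_nonneg minor_weight_nonneg)
    show "0 \<le> w (\<phi> p)" if "p \<in> {..<k}" for p
      using PiE_mem[of \<phi> "{..<k}" "\<lambda>_. {..<N}" p] \<open>\<phi> \<in> \<Phi>0\<close> that g(1)[of "\<phi> p"]
      by (simp add: \<Phi>0_def w_def)
  qed (simp add: y_def)
  \<comment> \<open>The share of a positive term that pays for the negative term in which \<open>l\<close> was replaced by \<open>N\<close>.\<close>
  define \<kappa> where "\<kappa> l = - g N * (node_ratio N e l * (\<rho> powr (e N - e l) / g l))" for l
  have \<kappa>: "0 \<le> \<kappa> l" if "l < N" for l
    unfolding \<kappa>_def using g(1)[OF that] g(2)
    by (intro mult_nonneg_nonneg divide_nonneg_pos node_ratio_nonneg) auto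
  have "sum (\<lambda>\<phi>. - T \<phi>) \<Phi>1 \<le> (\<Sum>(l, \<psi>)\<in>{..<N} \<times> \<Phi>0. \<kappa> l * T \<psi>)"
  proof (rule sum_le_included[where i = "\<lambda>(l, \<psi>). restrict (\<lambda>p. if \<psi> p = l then N else \<psi> p) {..<k}"])
    show "\<forall>z\<in>{..<N} \<times> \<Phi>0. 0 \<le> (case z of (l, \<psi>) \<Rightarrow> \<kappa> l * T \<psi>)"
      using T0 \<kappa> by auto
    show "\<forall>\<phi>\<in>\<Phi>1. \<exists>z\<in>{..<N} \<times> \<Phi>0.
        (case z of (l, \<psi>) \<Rightarrow> restrict (\<lambda>p. if \<psi> p = l then N else \<psi> p) {..<k}) = \<phi>
        \<and> - T \<phi> \<le> (case z of (l, \<psi>) \<Rightarrow> \<kappa> l * T \<psi>)"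
    proof
      fix \<phi> assume "\<phi> \<in> \<Phi>1"
      then have inj: "inj_on \<phi> {..<k}" and \<phi>: "\<phi> \<in> PiE {..<k} (\<lambda>_. {..N})"
        and "N \<in> \<phi> ` {..<k}" by (auto simp: \<Phi>1_def \<Phi>_def)
      then obtain p0 where p0: "p0 < k" "\<phi> p0 = N" by auto
      let ?K = "{..<k} - {p0}"
      have other: "\<phi> p < N" if "p \<in> ?K" for p
      proof -
        have "\<phi> p \<noteq> \<phi> p0" using inj_onD[OF inj] that p0 by blast
        then show ?thesis using PiE_mem[OF \<phi>, of p] that p0 by simp
      qed
      have "card (\<phi> ` ?K) \<le> card ?K" by (rule card_image_le) simp
      also have "\<dots> < N" using p0 k by (simp add: card_Diff_singleton)
      finally have card: "card (\<phi> ` ?K) < card {..<N}" by simp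
      have ne: "{..<N} - \<phi> ` ?K \<noteq> {}"
      proof
        assume "{..<N} - \<phi> ` ?K = {}"
        then have "{..<N} \<subseteq> \<phi> ` ?K" by blast
        then have "card {..<N} \<le> card (\<phi> ` ?K)" by (intro card_mono) auto
        then show False using card by simp
      qed
      \<comment> \<open>At most \<open>k - 1 < N\<close> of the lower nodes are in use, so a largest unused one exists.\<close>
      define l where "l = Max ({..<N} - \<phi> ` ?K)"
      have l: "l < N" "l \<notin> \<phi> ` ?K" using Max_in[OF _ ne] by (auto simp: l_def)
      have top: "m \<in> \<phi> ` ?K" if "m < N" "l < m" for m
      proof (rule ccontr)
        assume "m \<notin> \<phi> ` ?K"
        then have "m \<le> l" unfolding l_def using that by (intro Max_ge) auto
        then show False using that by simp
      qed
      let ?\<psi> = "\<phi>(p0 := l)"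
      have \<psi>: "?\<psi> \<in> \<Phi>0"
        unfolding \<Phi>0_def
      proof (rule PiE_I)
        show "?\<psi> p \<in> {..<N}" if "p \<in> {..<k}" for p using other l that by auto
        show "?\<psi> p = undefined" if "p \<notin> {..<k}" for p using PiE_arb[OF \<phi> that] p0 that by auto
      qed
      have restored: "restrict (\<lambda>p. if ?\<psi> p = l then N else ?\<psi> p) {..<k} = \<phi>"
      proof
        fix p
        show "restrict (\<lambda>p. if ?\<psi> p = l then N else ?\<psi> p) {..<k} p = \<phi> p"
          using l(2) p0 PiE_arb[OF \<phi>, of p] by (cases "p < k") auto
      qed
      have sub: "\<phi> ` ?K \<subseteq> {..<N}" using other by auto
      have "minor_weight k i j (y \<circ> \<phi>) \<le> node_ratio N e l * minor_weight k i j (y \<circ> ?\<psi>)"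
        unfolding y_def by (rule minor_weight_exchange[OF e r inj p0 sub l top])
      moreover have "a powr e N \<le> \<rho> powr (e N - e l) * a powr e l"
      proof -
        have "e l < e N" using e l by (auto simp: strict_mono_on_def)
        then have "a powr (e N - e l) * a powr e l \<le> \<rho> powr (e N - e l) * a powr e l"
          using a by (intro mult_right_mono powr_mono2) auto
        then show ?thesis by (simp flip: powr_add)
      qed
      moreover have "0 \<le> minor_weight k i j (y \<circ> ?\<psi>)" "0 \<le> minor_weight k i j (y \<circ> \<phi>)"
        by (auto intro!: minor_weight_nonneg simp: y_def)
      ultimately have "a powr e N * minor_weight k i j (y \<circ> \<phi>)
          \<le> (\<rho> powr (e N - e l) * a powr e l) * (node_ratio N e l * minor_weight k i j (y \<circ> ?\<psi>))"
        by (intro mult_mono) auto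
      moreover have "0 \<le> - g N * (\<Prod>p\<in>?K. w (\<phi> p))"
        using g(1)[OF other] g(2) by (intro mult_nonneg_nonneg prod_nonneg) (auto simp: w_def less_imp_le)
      ultimately have ineq: "(- g N * (\<Prod>p\<in>?K. w (\<phi> p))) * (a powr e N * minor_weight k i j (y \<circ> \<phi>))
          \<le> (- g N * (\<Prod>p\<in>?K. w (\<phi> p)))
            * ((\<rho> powr (e N - e l) * a powr e l) * (node_ratio N e l * minor_weight k i j (y \<circ> ?\<psi>)))"
        by (rule mult_left_mono)
      have K: "{..<k} = insert p0 ?K" using p0 by auto
      have split: "(\<Prod>p<k. w (\<chi> p)) = w (\<chi> p0) * (\<Prod>p\<in>?K. w (\<chi> p))" for \<chi>
        by (subst K, rule prod.insert) auto
      have "(\<Prod>p\<in>?K. w (?\<psi> p)) = (\<Prod>p\<in>?K. w (\<phi> p))" by (rule prod.cong) auto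
      then have "\<kappa> l * T ?\<psi> = (- g N * (\<Prod>p\<in>?K. w (\<phi> p)))
            * ((\<rho> powr (e N - e l) * a powr e l) * (node_ratio N e l * minor_weight k i j (y \<circ> ?\<psi>)))"
        using g(1)[OF l(1)] unfolding T_def split \<kappa>_def by (simp add: w_def)
      moreover have "- T \<phi> = (- g N * (\<Prod>p\<in>?K. w (\<phi> p))) * (a powr e N * minor_weight k i j (y \<circ> \<phi>))"
        unfolding T_def split p0(2) by (simp add: w_def)
      ultimately have "- T \<phi> \<le> \<kappa> l * T ?\<psi>" using ineq by simp
      then show "\<exists>z\<in>{..<N} \<times> \<Phi>0.
          (case z of (l, \<psi>) \<Rightarrow> restrict (\<lambda>p. if \<psi> p = l then N else \<psi> p) {..<k}) = \<phi>
          \<and> - T \<phi> \<le> (case z of (l, \<psi>) \<Rightarrow> \<kappa> l * T \<psi>)"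
        using restored \<psi> l(1) by (intro bexI[of _ "(l, ?\<psi>)"]) auto
    qed
  qed (use fin in auto)
  also have "\<dots> = (\<Sum>l<N. \<kappa> l) * sum T \<Phi>0"
    by (simp add: sum.cartesian_product[symmetric] sum_product)
  also have "(\<Sum>l<N. \<kappa> l) = - g N * threshold N e g \<rho>"
    by (simp add: \<kappa>_def threshold_def sum_distrib_left)
  also have "\<dots> * sum T \<Phi>0 \<le> 1 * sum T \<Phi>0"
    using g(3) T0 by (intro mult_right_mono sum_nonneg)
  finally have "0 \<le> sum T \<Phi>" unfolding decomp by (simp add: sum_negf)
  then have "0 \<le> fact k * array_det k (\<lambda>p q. \<Sum>m\<le>N. w m * y m ^ (i p + j q))"
    unfolding exponential_sum_minor[OF finite_atMost ij] T_def \<Phi>_def .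
  then have "0 \<le> array_det k (\<lambda>p q. \<Sum>m\<le>N. w m * y m ^ (i p + j q))"
    by (intro mult_left_le_imp_le[of "fact k" 0]) simp_all
  then show ?thesis by (simp only: w_def y_def)
qed

text \<open>For \<open>r > 1\<close>, reading the geometric Hankel matrix from its last entry backwards turns \<open>r\<close> into
  \<open>1 / r\<close> and \<open>a\<close> into the last entry \<open>a * r ^ (2 * (N - 1))\<close>, which obeys the same bound \<open>\<rho>\<close>.\<close>

lemma minor_nonneg_neg_coeff:
  assumes e: "strict_mono_on {..N} e"
    and g: "\<And>l. l < N \<Longrightarrow> 0 < g l" "g N < 0" "- g N * threshold N e g \<rho> \<le> 1"
    and a: "0 < a" "a \<le> \<rho>" "a * r ^ (2 * (N - 1)) \<le> \<rho>" and r: "0 < r"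
    and ij: "strict_mono_on {..<k} i" "strict_mono_on {..<k} j"
      "\<And>p. p < k \<Longrightarrow> i p < N" "\<And>p. p < k \<Longrightarrow> j p < N"
  shows "0 \<le> array_det k (\<lambda>p q. \<Sum>m\<le>N. (g m * a powr e m) * (r powr e m) ^ (i p + j q))"
proof -
  have "inj_on i {..<k}" using ij(1) by (rule strict_mono_on_imp_inj_on)
  then have "card {..<k} \<le> card {..<N}"
    by (rule card_inj_on_le) (use ij(3) in auto)
  then have k: "k \<le> N" by simp
  show ?thesis
  proof (cases "r \<le> 1")
    case True
    then show ?thesis using minor_nonneg_neg_coeff_contracting[OF e g a(1,2) r _ ij(1,2) k] by simp
  next
    case False
    define \<sigma> where "\<sigma> p = (if p < k then k - 1 - p else p)" for p
    define flip where "flip i p = N - 1 - i (\<sigma> p)" for i :: "nat \<Rightarrow> nat" and p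
    have \<sigma>: "\<sigma> permutes {..<k}"
      by (rule bij_imp_permutes, rule bij_betw_byWitness[where f' = \<sigma>]) (auto simp: \<sigma>_def)
    have flip: "strict_mono_on {..<k} (flip i)"
      if i: "strict_mono_on {..<k} i" "\<And>p. p < k \<Longrightarrow> i p < N" for i
    proof (rule strict_mono_onI)
      fix p q assume pq: "p \<in> {..<k}" "q \<in> {..<k}" "p < q"
      then have "i (\<sigma> q) < i (\<sigma> p)"
        by (intro strict_mono_onD[OF i(1)]) (auto simp: \<sigma>_def)
      moreover have "i (\<sigma> p) < N" using pq by (intro i(2)) (auto simp: \<sigma>_def)
      ultimately show "flip i p < flip i q" by (simp add: flip_def)
    qed
    let ?a = "a * r ^ (2 * (N - 1))" and ?s = "1 / r"
    have "0 \<le> array_det k (\<lambda>p q. \<Sum>m\<le>N. (g m * ?a powr e m) * (?s powr e m) ^ (flip i p + flip j q))"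
      by (rule minor_nonneg_neg_coeff_contracting[OF e g _ a(3) _ _ flip flip k])
         (use False a r ij in auto)
    also have "\<dots> = array_det k (\<lambda>p q. \<Sum>m\<le>N. (g m * a powr e m)
        * (r powr e m) ^ (i (\<sigma> p) + j (\<sigma> q)))"
    proof (intro array_det_cong sum.cong refl)
      fix p q m assume pq: "p < k" "q < k"
      have "i (\<sigma> p) < N" "j (\<sigma> q) < N" using pq ij by (auto simp: \<sigma>_def)
      then have exps: "2 * (N - 1) = (flip i p + flip j q) + (i (\<sigma> p) + j (\<sigma> q))"
        by (simp add: flip_def)
      have "?a powr e m = a powr e m * (r powr e m) ^ (2 * (N - 1))"
        using a r by (simp add: powr_mult powr_powr mult.commute flip: powr_realpow)
      moreover have "?s powr e m = inverse (r powr e m)"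
        using r by (simp add: powr_divide inverse_eq_divide)
      moreover have "R ^ (u + v) * inverse R ^ u = R ^ v" if "R > 0" for R :: real and u v
        using that by (simp add: power_add power_inverse)
      moreover have "r powr e m > 0" using r by simp
      ultimately show "(g m * ?a powr e m) * (?s powr e m) ^ (flip i p + flip j q)
          = (g m * a powr e m) * (r powr e m) ^ (i (\<sigma> p) + j (\<sigma> q))"
        unfolding exps by (simp only: mult.assoc)
    qed
    also have "\<dots> = array_det k (\<lambda>p q. \<Sum>m\<le>N. (g m * a powr e m) * (r powr e m) ^ (i p + j q))"
      by (rule array_det_permute_both[OF \<sigma>])
    finally show ?thesis .
  qed
qed

section \<open>Coefficients from positivity\<close>

lemma lagrange_interpolation:
  fixes y z :: "nat \<Rightarrow> real"
  assumes inj: "inj_on y {..<N}" and N: "0 < N"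
  obtains P where "degree P < N" "\<And>l. l < N \<Longrightarrow> poly P (y l) = z l"
    "\<And>t. poly P t = (\<Sum>l<N. z l * (\<Prod>m\<in>{..<N} - {l}. (t - y m) / (y l - y m)))"
proof -
  define b where "b l = (\<Prod>m\<in>{..<N} - {l}. Polynomial.smult (inverse (y l - y m)) [:- y m, 1:])" for l
  define P where "P = (\<Sum>l<N. Polynomial.smult (z l) (b l))"
  have b: "poly (b l) t = (\<Prod>m\<in>{..<N} - {l}. (t - y m) / (y l - y m))" for l t
    unfolding b_def poly_prod by (rule prod.cong) (simp_all add: divide_inverse algebra_simps)
  have P: "poly P t = (\<Sum>l<N. z l * (\<Prod>m\<in>{..<N} - {l}. (t - y m) / (y l - y m)))" for t
    by (simp add: P_def poly_sum b)
  have "degree (b l) \<le> N - 1" if "l < N" for l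
  proof -
    have "degree (b l) \<le> sum (degree \<circ> (\<lambda>m. Polynomial.smult (inverse (y l - y m)) [:- y m, 1:])) ({..<N} - {l})"
      unfolding b_def by (rule degree_prod_sum_le) simp
    also have "\<dots> \<le> (\<Sum>m\<in>{..<N} - {l}. 1)"
      unfolding comp_def by (intro sum_mono order_trans[OF degree_smult_le]) simp
    finally show ?thesis using that by simp
  qed
  then have "degree P \<le> N - 1"
    unfolding P_def by (intro degree_sum_le order_trans[OF degree_smult_le]) auto
  then have "degree P < N" using N by linarith
  moreover have "poly P (y l) = z l" if l: "l < N" for l
  proof -
    have "(\<Prod>m\<in>{..<N} - {l'}. (y l - y m) / (y l' - y m)) = (if l' = l then 1 else 0)"
      if "l' < N" for l'
    proof (cases "l' = l")
      case True
      have "(\<Prod>m\<in>{..<N} - {l}. (y l - y m) / (y l - y m)) = 1"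
      proof (rule prod.neutral, rule ballI)
        fix m assume "m \<in> {..<N} - {l}"
        then show "(y l - y m) / (y l - y m) = 1" using inj_onD[OF inj, of l m] l by auto
      qed
      then show ?thesis using True by simp
    next
      case False
      then show ?thesis using l by (auto intro!: prod_zero)
    qed
    then have "poly P (y l) = (\<Sum>l'<N. z l' * (if l' = l then 1 else 0))"
      unfolding P by (intro sum.cong) auto
    also have "\<dots> = z l * (if l = l then 1 else 0)"
      by (rule sum_only_index) (use l in auto)
    finally show ?thesis by simp
  qed
  ultimately show ?thesis using P that by blast
qed

text \<open>The matrix is the combination of the rank-one matrices built from the vectors of powers of the
  nodes, and pairing such a vector with the coefficients of \<open>P\<close> evaluates \<open>P\<close> at the node.\<close>

lemma hankel_form_poly:
  fixes w y :: "nat \<Rightarrow> real"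
  assumes "degree P < N"
  shows "(\<Sum>p<N. \<Sum>q<N. coeff P p * (\<Sum>m\<in>A. w m * y m ^ (p + q)) * coeff P q)
       = (\<Sum>m\<in>A. w m * (poly P (y m))\<^sup>2)"
proof -
  have poly: "poly P t = (\<Sum>p<N. coeff P p * t ^ p)" for t
    unfolding poly_altdef
    by (rule sum.mono_neutral_left) (use assms in \<open>auto simp: coeff_eq_0\<close>)
  have sq: "(poly P t)\<^sup>2 = (\<Sum>p<N. \<Sum>q<N. (coeff P p * t ^ p) * (coeff P q * t ^ q))" for t
    by (simp only: poly power2_eq_square sum_product)
  have "(\<Sum>m\<in>A. w m * (poly P (y m))\<^sup>2)
      = (\<Sum>m\<in>A. \<Sum>p<N. \<Sum>q<N. w m * ((coeff P p * y m ^ p) * (coeff P q * y m ^ q)))"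
    by (simp only: sq sum_distrib_left)
  also have "\<dots> = (\<Sum>p<N. \<Sum>m\<in>A. \<Sum>q<N. w m * ((coeff P p * y m ^ p) * (coeff P q * y m ^ q)))"
    by (rule sum.swap)
  also have "\<dots> = (\<Sum>p<N. \<Sum>q<N. \<Sum>m\<in>A. w m * ((coeff P p * y m ^ p) * (coeff P q * y m ^ q)))"
    by (rule sum.cong[OF refl], rule sum.swap)
  also have "\<dots> = (\<Sum>p<N. \<Sum>q<N. coeff P p * (\<Sum>m\<in>A. w m * y m ^ (p + q)) * coeff P q)"
    by (simp add: sum_distrib_left sum_distrib_right power_add mult_ac)
  finally show ?thesis ..
qed

text \<open>The Lagrange coefficient of the node \<open>r powr e l\<close> for evaluation at \<open>r powr e N\<close>; its square
  tends to \<open>node_ratio\<close> as \<open>r\<close> tends to \<open>1\<close>.\<close>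

definition node_quotient :: "nat \<Rightarrow> (nat \<Rightarrow> real) \<Rightarrow> real \<Rightarrow> nat \<Rightarrow> real" where
  "node_quotient N e r l = (\<Prod>m\<in>{..<N} - {l}. (r powr e N - r powr e m) / (r powr e l - r powr e m))"

text \<open>The positive semidefinite Hankel form, with its vectors read as polynomials of degree below \<open>N\<close>
  and these given by their arbitrary values \<open>z\<close> at the first \<open>N\<close> nodes.\<close>

lemma quadratic_form_at_nodes:
  assumes psd: "\<And>v. 0 \<le> (\<Sum>p<N. \<Sum>q<N. v p * (\<Sum>m\<le>N. w m * (r powr e m) ^ (p + q)) * v q)"
    and e: "inj_on e {..N}" and N: "0 < N" and r: "0 < r" "r \<noteq> 1"
  shows "0 \<le> (\<Sum>l<N. w l * (z l)\<^sup>2) + w N * (\<Sum>l<N. z l * node_quotient N e r l)\<^sup>2"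
proof -
  have inj: "inj_on (\<lambda>m. r powr e m) {..<N}"
    using e r by (auto simp: inj_on_def powr_inj)
  obtain P where P: "degree P < N" "\<And>l. l < N \<Longrightarrow> poly P (r powr e l) = z l"
    "\<And>t. poly P t = (\<Sum>l<N. z l * (\<Prod>m\<in>{..<N} - {l}. (t - r powr e m) / (r powr e l - r powr e m)))"
    by (rule lagrange_interpolation[OF inj N, of z]) (rule that)
  have "0 \<le> (\<Sum>m\<le>N. w m * (poly P (r powr e m))\<^sup>2)"
    using psd[of "coeff P"] unfolding hankel_form_poly[OF P(1)] .
  also have "\<dots> = (\<Sum>l<N. w l * (poly P (r powr e l))\<^sup>2) + w N * (poly P (r powr e N))\<^sup>2"
    by (simp add: lessThan_Suc_atMost[symmetric])
  also have "(\<Sum>l<N. w l * (poly P (r powr e l))\<^sup>2) = (\<Sum>l<N. w l * (z l)\<^sup>2)"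
    by (rule sum.cong) (simp_all add: P(2))
  also have "poly P (r powr e N) = (\<Sum>l<N. z l * node_quotient N e r l)"
    unfolding P(3) node_quotient_def ..
  finally show ?thesis .
qed

lemma node_quotient_nonzero:
  assumes e: "inj_on e {..N}" and "l < N" and r: "0 < r" "r \<noteq> 1"
  shows "node_quotient N e r l \<noteq> 0"
proof -
  have "r powr e m \<noteq> r powr e m'" if "m \<le> N" "m' \<le> N" "m \<noteq> m'" for m m'
    using inj_onD[OF e, of m m'] that r by (auto simp: powr_inj)
  then show ?thesis using assms(2) by (auto simp: node_quotient_def)
qed

text \<open>Numerator and denominator, divided by \<open>\<epsilon>\<close>, are difference quotients at \<open>0\<close>.\<close>

lemma tendsto_exp_quotient:
  fixes s t u :: real
  assumes "t \<noteq> u"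
  shows "((\<lambda>\<epsilon>. (exp (- \<epsilon>) powr s - exp (- \<epsilon>) powr u) / (exp (- \<epsilon>) powr t - exp (- \<epsilon>) powr u))
    \<longlongrightarrow> (s - u) / (t - u)) (at_right 0)"
proof -
  have deriv: "((\<lambda>\<epsilon>. (exp (- \<epsilon>) powr a - exp (- \<epsilon>) powr u) / \<epsilon>) \<longlongrightarrow> u - a) (at_right 0)" for a
  proof -
    have "((\<lambda>\<epsilon>. exp (- \<epsilon> * a) - exp (- \<epsilon> * u)) has_real_derivative (u - a)) (at 0)"
      by (auto intro!: derivative_eq_intros)
    then have "((\<lambda>\<epsilon>. exp (- \<epsilon> * a) - exp (- \<epsilon> * u)) has_real_derivative (u - a)) (at 0 within {0<..})"
      by (rule has_field_derivative_at_within)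
    then show ?thesis
      by (simp add: has_field_derivative_iff powr_def mult.commute)
  qed
  have "((\<lambda>\<epsilon>. ((exp (- \<epsilon>) powr s - exp (- \<epsilon>) powr u) / \<epsilon>) / ((exp (- \<epsilon>) powr t - exp (- \<epsilon>) powr u) / \<epsilon>))
      \<longlongrightarrow> (u - s) / (u - t)) (at_right 0)"
    by (intro tendsto_divide deriv) (use assms in auto)
  moreover have "(u - s) / (u - t) = (s - u) / (t - u)"
    using minus_divide_divide[of "s - u" "t - u"] by simp
  moreover have "\<forall>\<^sub>F \<epsilon> in at_right 0.
      ((exp (- \<epsilon>) powr s - exp (- \<epsilon>) powr u) / \<epsilon>) / ((exp (- \<epsilon>) powr t - exp (- \<epsilon>) powr u) / \<epsilon>)
      = (exp (- \<epsilon>) powr s - exp (- \<epsilon>) powr u) / (exp (- \<epsilon>) powr t - exp (- \<epsilon>) powr u)"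
    using eventually_at_right_less[of "0::real"] by eventually_elim auto
  ultimately show ?thesis by (simp only: filterlim_cong[OF refl refl])
qed

text \<open>Evaluating the form at the unit vector of a node and letting \<open>a\<close> tend to \<open>0\<close> isolates the
  coefficient of that node, since \<open>e N\<close> is the largest exponent. If \<open>g N\<close> is negative, the same
  inequality bounds the coefficient away from \<open>0\<close>, and by Cauchy and Schwarz the sharpest inequality
  comes from the values \<open>d l / (g l * a powr e l)\<close>. Its limit for \<open>r\<close> tending to \<open>1\<close> and \<open>a\<close> to \<open>\<rho>\<close>
  involves the threshold.\<close>

lemma coefficients_of_psd:
  assumes psd: "\<And>a r v. 0 < a \<Longrightarrow> a < \<rho> \<Longrightarrow> 0 < r \<Longrightarrow> r < 1 \<Longrightarrow>
      0 \<le> (\<Sum>p<N. \<Sum>q<N. v p * (\<Sum>m\<le>N. (g m * a powr e m) * (r powr e m) ^ (p + q)) * v q)"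
    and e: "strict_mono_on {..N} e" and N: "0 < N" and \<rho>: "0 < \<rho>"
  shows "(\<forall>l<N. 0 \<le> g l) \<and> (g N < 0 \<longrightarrow> (\<forall>l<N. 0 < g l) \<and> - g N * threshold N e g \<rho> \<le> 1)"
proof -
  have inj: "inj_on e {..N}" using e by (rule strict_mono_on_imp_inj_on)
  have lt: "e l < e N" if "l < N" for l
    using e that by (auto simp: strict_mono_on_def)
  have form: "0 \<le> (\<Sum>l<N. g l * a powr e l * (z l)\<^sup>2)
      + g N * a powr e N * (\<Sum>l<N. z l * node_quotient N e r l)\<^sup>2"
    if "0 < a" "a < \<rho>" "0 < r" "r < 1" for a r z
    by (rule quadratic_form_at_nodes[where w = "\<lambda>m. g m * a powr e m" and r = r])
       (use psd inj N that in auto)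
  have single: "0 \<le> g l + g N * (node_quotient N e (1/2) l)\<^sup>2 * a powr (e N - e l)"
    if "l < N" "0 < a" "a < \<rho>" for l a
  proof -
    let ?z = "\<lambda>m. if m = l then 1 else (0::real)"
    have "(\<Sum>m<N. g m * a powr e m * (?z m)\<^sup>2) = g l * a powr e l * (?z l)\<^sup>2"
      by (rule sum_only_index) (use that in auto)
    moreover have "(\<Sum>m<N. ?z m * node_quotient N e (1/2) m) = ?z l * node_quotient N e (1/2) l"
      by (rule sum_only_index) (use that in auto)
    ultimately have "0 \<le> g l * a powr e l + g N * a powr e N * (node_quotient N e (1/2) l)\<^sup>2"
      using form[of a "1/2" ?z] that by simp
    also have "\<dots> = a powr e l * (g l + g N * (node_quotient N e (1/2) l)\<^sup>2 * a powr (e N - e l))"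
      using that by (simp add: powr_diff field_simps)
    finally show ?thesis using that by (simp add: zero_le_mult_iff)
  qed
  have nonneg: "0 \<le> g l" if l: "l < N" for l
  proof -
    have "((\<lambda>a. g l + g N * (node_quotient N e (1/2) l)\<^sup>2 * a powr (e N - e l))
        \<longlongrightarrow> g l + g N * (node_quotient N e (1/2) l)\<^sup>2 * 0) (at_right 0)"
    proof (intro tendsto_add tendsto_mult tendsto_const)
      have "((\<lambda>a::real. a powr (e N - e l)) \<longlongrightarrow> 0 powr (e N - e l)) (at_right 0)"
        by (rule tendsto_powr') (use lt[OF l] in \<open>auto intro!: tendsto_intros simp: eventually_at_right_less less_imp_le eventually_at_filter\<close>)
      then show "((\<lambda>a::real. a powr (e N - e l)) \<longlongrightarrow> 0) (at_right 0)" by simp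
    qed
    moreover have "\<forall>\<^sub>F a in at_right 0. 0 \<le> g l + g N * (node_quotient N e (1/2) l)\<^sup>2 * a powr (e N - e l)"
      using eventually_at_right_less[of "0::real"] eventually_at_right_field[of "\<lambda>a. a < \<rho>" 0]
      by (rule eventually_mono[OF eventually_conj[OF _ iffD2]]) (use \<rho> single[OF l] in auto)
    ultimately show ?thesis
      using tendsto_lowerbound[of _ _ "at_right 0" 0] by fastforce
  qed
  moreover have "(\<forall>l<N. 0 < g l) \<and> - g N * threshold N e g \<rho> \<le> 1" if neg: "g N < 0"
  proof -
    have pos: "0 < g l" if l: "l < N" for l
    proof -
      have "node_quotient N e (1/2) l \<noteq> 0" by (rule node_quotient_nonzero[OF inj l]) auto
      then have "g N * (node_quotient N e (1/2) l)\<^sup>2 * (\<rho>/2) powr (e N - e l) < 0"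
        using neg \<rho> by (simp add: mult_neg_pos)
      then show ?thesis using single[OF l, of "\<rho>/2"] \<rho> by simp
    qed
    let ?Q = "\<lambda>a r. \<Sum>l<N. (node_quotient N e r l)\<^sup>2 * (a powr (e N - e l) / g l)"
    have Q: "0 \<le> 1 + g N * ?Q a r" if a: "0 < a" "a < \<rho>" and r: "0 < r" "r < 1" for a r
    proof -
      define d where "d = node_quotient N e r"
      define S where "S = (\<Sum>l<N. (d l)\<^sup>2 / (g l * a powr e l))"
      have "d l \<noteq> 0" if "l < N" for l
        unfolding d_def by (rule node_quotient_nonzero[OF inj that]) (use r in auto)
      then have S: "0 < S"
        unfolding S_def using N pos a by (intro sum_pos) auto
      have "(\<Sum>l<N. g l * a powr e l * (d l / (g l * a powr e l))\<^sup>2) = S"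
        unfolding S_def
      proof (rule sum.cong[OF refl])
        fix l assume "l \<in> {..<N}"
        then have "g l * a powr e l \<noteq> 0" using pos[of l] a by simp
        then show "g l * a powr e l * (d l / (g l * a powr e l))\<^sup>2 = (d l)\<^sup>2 / (g l * a powr e l)"
          by (simp add: power2_eq_square)
      qed
      moreover have "(\<Sum>l<N. d l / (g l * a powr e l) * d l) = S"
        unfolding S_def by (simp add: power2_eq_square)
      ultimately have "0 \<le> S + g N * a powr e N * S\<^sup>2"
        using form[OF a r, of "\<lambda>l. d l / (g l * a powr e l)"] unfolding d_def[symmetric] by simp
      also have "\<dots> = S * (1 + g N * (a powr e N * S))" by (simp add: power2_eq_square algebra_simps)
      finally have "0 \<le> 1 + g N * (a powr e N * S)" using S by (simp add: zero_le_mult_iff)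
      moreover have "a powr e N * S = ?Q a r"
        unfolding S_def d_def using a by (simp add: sum_distrib_left powr_diff mult_ac)
      ultimately show ?thesis by simp
    qed
    have nr: "((\<lambda>\<epsilon>. (node_quotient N e (exp (- \<epsilon>)) l)\<^sup>2) \<longlongrightarrow> node_ratio N e l) (at_right 0)"
      if l: "l < N" for l
      unfolding node_quotient_def node_ratio_def prod_power_distrib
      by (intro tendsto_prod tendsto_power tendsto_exp_quotient)
         (use inj_onD[OF inj] l in fastforce)
    have "((\<lambda>\<epsilon>. 1 + g N * ?Q (\<rho> * exp (- \<epsilon>)) (exp (- \<epsilon>))) \<longlongrightarrow> 1 + g N * threshold N e g \<rho>) (at_right 0)"
      unfolding threshold_def
    proof (intro tendsto_add tendsto_mult tendsto_const tendsto_sum tendsto_divide nr)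
      have "((\<lambda>\<epsilon>. (\<rho> * exp (- \<epsilon>)) powr (e N - e l)) \<longlongrightarrow> (\<rho> * exp (- 0)) powr (e N - e l)) (at_right 0)" for l
        using \<rho> by (intro tendsto_intros) auto
      then show "((\<lambda>\<epsilon>. (\<rho> * exp (- \<epsilon>)) powr (e N - e l)) \<longlongrightarrow> \<rho> powr (e N - e l)) (at_right 0)" for l
        by simp
      show "g l \<noteq> 0" if "l \<in> {..<N}" for l using pos[of l] that by simp
    qed auto
    moreover have "\<forall>\<^sub>F \<epsilon> in at_right 0. 0 \<le> 1 + g N * ?Q (\<rho> * exp (- \<epsilon>)) (exp (- \<epsilon>))"
      using eventually_at_right_less[of "0::real"]
      by (rule eventually_mono) (rule Q, use \<rho> in auto)
    ultimately have "0 \<le> 1 + g N * threshold N e g \<rho>"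
      using tendsto_lowerbound[of _ _ "at_right 0" 0] by fastforce
    then show ?thesis using pos by simp
  qed
  ultimately show ?thesis by blast
qed

section \<open>Rank-one Hankel matrices and total non-negativity\<close>

lemma submatrix_image:
  assumes "strict_mono_on {..<k} i" "\<And>p. p < k \<Longrightarrow> i p < dim_row A"
    and "strict_mono_on {..<k} j" "\<And>p. p < k \<Longrightarrow> j p < dim_col A"
  shows "submatrix A (i ` {..<k}) (j ` {..<k}) = mat k k (\<lambda>(p, q). A $$ (i p, j q))"
proof -
  have pick: "pick (i ` {..<k}) p = i p" if i: "strict_mono_on {..<k} i" and p: "p < k"
    for i :: "nat \<Rightarrow> nat" and p
  proof -
    have less_iff: "i q < i p \<longleftrightarrow> q < p" if "q < k" for q
      using strict_mono_on_less[OF i] that p by simp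
    have "{a \<in> i ` {..<k}. a < i p} = i ` {..<p}"
      using less_iff p by force
    moreover have "card (i ` {..<p}) = p"
    proof -
      have "inj_on i {..<p}"
        using strict_mono_on_imp_inj_on[OF i] by (rule inj_on_subset) (use p in auto)
      then show ?thesis by (simp add: card_image)
    qed
    ultimately show ?thesis
      using pick_card_in_set[of "i p" "i ` {..<k}"] p by simp
  qed
  have card: "card {x. x < n \<and> x \<in> i ` {..<k}} = k"
    if i: "strict_mono_on {..<k} i" "\<And>p. p < k \<Longrightarrow> i p < n" for i :: "nat \<Rightarrow> nat" and n
  proof -
    have "{x. x < n \<and> x \<in> i ` {..<k}} = i ` {..<k}" using i(2) by auto
    then show ?thesis using card_image[OF strict_mono_on_imp_inj_on[OF i(1)]] by simp
  qed
  have "card {x. x < dim_row A \<and> x \<in> i ` {..<k}} = k" "card {x. x < dim_col A \<and> x \<in> j ` {..<k}} = k"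
    by (rule card; use assms in simp)+
  then show ?thesis
    unfolding submatrix_def by (intro eq_matI) (simp_all add: pick assms)
qed

lemma totally_nonneg_iff_minors:
  assumes A: "A \<in> carrier_mat N N"
  shows "totally_nonneg A \<longleftrightarrow>
    (\<forall>k i j. strict_mono_on {..<k} i \<longrightarrow> strict_mono_on {..<k} j \<longrightarrow>
       (\<forall>p<k. i p < N) \<longrightarrow> (\<forall>p<k. j p < N) \<longrightarrow> 0 \<le> array_det k (\<lambda>p q. A $$ (i p, j q)))"
    (is "_ \<longleftrightarrow> ?minors")
proof
  assume tn: "totally_nonneg A"
  show ?minors
  proof (intro allI impI)
    fix k and i j :: "nat \<Rightarrow> nat"
    assume i: "strict_mono_on {..<k} i" and j: "strict_mono_on {..<k} j"
      and "\<forall>p<k. i p < N" "\<forall>p<k. j p < N"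
    then have "submatrix A (i ` {..<k}) (j ` {..<k}) = mat k k (\<lambda>(p, q). A $$ (i p, j q))"
      using A by (intro submatrix_image) auto
    moreover have "card (i ` {..<k}) = card (j ` {..<k})"
      using i j by (simp add: card_image strict_mono_on_imp_inj_on)
    moreover have "i ` {..<k} \<subseteq> {..<dim_row A}" "j ` {..<k} \<subseteq> {..<dim_col A}"
      using \<open>\<forall>p<k. i p < N\<close> \<open>\<forall>p<k. j p < N\<close> A by auto
    ultimately show "0 \<le> array_det k (\<lambda>p q. A $$ (i p, j q))"
      using tn unfolding totally_nonneg_def by metis
  qed
next
  assume minors: ?minors
  show "totally_nonneg A"
    unfolding totally_nonneg_def
  proof (intro allI impI, elim conjE)
    fix I J assume IJ: "I \<subseteq> {..<dim_row A}" "J \<subseteq> {..<dim_col A}" "card I = card J"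
    have "{x. x < dim_row A \<and> x \<in> I} = I" "{x. x < dim_col A \<and> x \<in> J} = J"
      using IJ by auto
    then have "submatrix A I J = mat (card I) (card I) (\<lambda>(p, q). A $$ (pick I p, pick J q))"
      by (simp add: submatrix_def IJ(3))
    moreover have "strict_mono_on {..<card I} (pick I)" "strict_mono_on {..<card I} (pick J)"
      using IJ(3) by (auto intro!: strict_mono_onI pick_mono_le)
    moreover have "\<forall>p<card I. pick I p < N" "\<forall>p<card I. pick J p < N"
      using IJ A pick_in_set_le[of _ I] pick_in_set_le[of _ J] by fastforce+
    ultimately show "0 \<le> det (submatrix A I J)" using minors by simp
  qed
qed

lemma quadratic_form_as_sum:
  fixes A :: "real mat"
  assumes "A \<in> carrier_mat N N" "v \<in> carrier_vec N"
  shows "v \<bullet> (A *\<^sub>v v) = (\<Sum>p<N. \<Sum>q<N. v $ p * A $$ (p, q) * v $ q)"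
  using assms
  by (simp add: scalar_prod_def mult_mat_vec_def sum_distrib_left mult.assoc atLeast0LessThan)

lemma totally_nonneg_symmetric_imp_psd:
  assumes A: "A \<in> carrier_mat N N" and sym: "transpose_mat A = A" and tn: "totally_nonneg A"
  shows "pos_semidef A"
  unfolding pos_semidef_def
proof (intro conjI ballI)
  fix v :: "real vec" assume "v \<in> carrier_vec (dim_row A)"
  then have v: "v \<in> carrier_vec N" using A by simp
  have "0 \<le> (\<Sum>p<N. \<Sum>q<N. v $ p * A $$ (p, q) * v $ q)"
  proof (rule quadratic_form_nonneg_of_principal_minors)
    show "A $$ (p, q) = A $$ (q, p)" if "p < N" "q < N" for p q
      using arg_cong[OF sym, of "\<lambda>B. B $$ (q, p)"] A that by simp
    show "0 \<le> array_det k (\<lambda>p q. A $$ (i p, i q))"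
      if "strict_mono_on {..<k} i" "\<forall>p<k. i p < N" for k i
      using tn that unfolding totally_nonneg_iff_minors[OF A] by blast
  qed
  then show "0 \<le> v \<bullet> (A *\<^sub>v v)" by (simp add: quadratic_form_as_sum[OF A v])
qed (use A sym in auto)

text \<open>The contiguous 2-by-2 minors vanish, so the defining sequence satisfies
  \<open>s u * s (u + 2) = (s (u + 1))\<^sup>2\<close> and, being positive, is geometric.\<close>

lemma rank_one_hankel_geometric:
  assumes A: "A \<in> HTN N {0<..<\<rho>}" and rank: "vec_space.rank N A = 1" and N: "0 < N"
  obtains a r where "0 < a" "a < \<rho>" "0 < r" "a * r ^ (2 * (N - 1)) < \<rho>"
    "\<And>p q. p < N \<Longrightarrow> q < N \<Longrightarrow> A $$ (p, q) = a * r ^ (p + q)"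
proof -
  have carr: "A \<in> carrier_mat N N" using A by (simp add: HTN_def)
  obtain s where s: "\<And>p q. p < N \<Longrightarrow> q < N \<Longrightarrow> A $$ (p, q) = s (p + q)"
    using A carr by (auto simp: HTN_def hankel_mat_def)
  have bounds: "0 < s u \<and> s u < \<rho>" if "u \<le> 2 * (N - 1)" for u
  proof -
    let ?p = "min u (N - 1)"
    have pq: "?p < N" "u - ?p < N" "?p + (u - ?p) = u" using that N by auto
    have "A $$ (?p, u - ?p) \<in> elements_mat A"
      using carr pq by (intro elements_matI[OF carr]) auto
    then show ?thesis using A s[OF pq(1,2)] pq(3) by (auto simp: HTN_def)
  qed
  have log_affine: "s u * s (u + 2) = (s (u + 1))\<^sup>2" if u: "u + 2 \<le> 2 * (N - 1)" for u
  proof -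
    define p where "p = min u (N - 2)"
    have pq: "Suc p < N" "Suc (u - p) < N" "p \<le> u" using u by (auto simp: p_def)
    define i where "i t = p + t" for t :: nat
    define j where "j t = (u - p) + t" for t :: nat
    have ij: "strict_mono_on {..<2} i" "strict_mono_on {..<2} j"
      by (auto simp: strict_mono_on_def i_def j_def)
    have lt: "i t < N" "j t < N" if "t < 2" for t
      using that pq by (auto simp: i_def j_def)
    have sub: "submatrix A (i ` {..<2}) (j ` {..<2}) = mat 2 2 (\<lambda>(p, q). A $$ (i p, j q))"
      by (rule submatrix_image) (use ij lt carr in auto)
    have "{x. x < N \<and> x \<in> j ` {..<2}} = j ` {..<2}" using lt by auto
    then have "card {x. x < N \<and> x \<in> j ` {..<2}} = 2"
      using card_image[OF strict_mono_on_imp_inj_on[OF ij(2)]] by simp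
    then have "array_det 2 (\<lambda>p q. A $$ (i p, j q)) = 0"
      using vec_space.rank_gt_minor[OF carr, of "i ` {..<2}" "j ` {..<2}"] rank sub by auto
    moreover have "A $$ (i 0, j 0) = s u" "A $$ (i 0, j 1) = s (u + 1)"
      "A $$ (i 1, j 0) = s (u + 1)" "A $$ (i 1, j 1) = s (u + 2)"
      using pq by (simp_all add: i_def j_def s)
    ultimately show ?thesis by (simp add: array_det_two power2_eq_square)
  qed
  \<comment> \<open>For \<open>N = 1\<close> the value \<open>s 1\<close> is not an entry of the matrix, and any ratio does.\<close>
  define r where "r = (if N = 1 then 1 else s 1 / s 0)"
  have s0: "0 < s 0" "s 0 < \<rho>" using bounds[of 0] by auto
  have r: "0 < r" using bounds[of 1] s0 N by (auto simp: r_def)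
  have ratio: "s (Suc u) = r * s u" if "Suc u \<le> 2 * (N - 1)" for u
    using that
  proof (induction u)
    case 0
    then show ?case using s0 by (auto simp: r_def)
  next
    case (Suc u)
    have "s u * s (Suc (Suc u)) = s u * (r * s (Suc u))"
      using log_affine[of u] Suc by (simp add: power2_eq_square mult_ac)
    then show ?case using bounds[of u] Suc.prems by simp
  qed
  have geo: "s u = s 0 * r ^ u" if "u \<le> 2 * (N - 1)" for u
    using that by (induction u) (simp_all add: ratio)
  show ?thesis
  proof (rule that[of "s 0" r])
    show "s 0 * r ^ (2 * (N - 1)) < \<rho>" using geo[of "2 * (N - 1)"] bounds[of "2 * (N - 1)"] by simp
    show "A $$ (p, q) = s 0 * r ^ (p + q)" if "p < N" "q < N" for p q
      using s[OF that] geo[of "p + q"] that by simp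
  qed (use s0 r in auto)
qed

lemma geometric_hankel_rank_one:
  assumes a: "0 < a" "a < \<rho>" and r: "0 < r" "r \<le> 1" and N: "0 < N"
  defines "A \<equiv> mat N N (\<lambda>(p, q). a * r ^ (p + q))"
  shows "A \<in> HTN N {0<..<\<rho>}" and "vec_space.rank N A = 1"
proof -
  have carr: "A \<in> carrier_mat N N" by (simp add: A_def)
  have entry: "A $$ (p, q) = a * r ^ (p + q)" if "p < N" "q < N" for p q
    using that by (simp add: A_def)
  have "totally_nonneg A"
    unfolding totally_nonneg_iff_minors[OF carr]
  proof (intro allI impI)
    fix k and i j :: "nat \<Rightarrow> nat"
    assume ij: "strict_mono_on {..<k} i" "strict_mono_on {..<k} j"
      and lt: "\<forall>p<k. i p < N" "\<forall>p<k. j p < N"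
    \<comment> \<open>A moment matrix with the single node \<open>r\<close> of positive mass \<open>a\<close>.\<close>
    have "0 \<le> array_det k (\<lambda>p q. \<Sum>m\<le>(0::nat). a * r ^ (i p + j q))"
      using minor_nonneg_nonneg_coeffs[OF ij, of 0 "\<lambda>_. a" "\<lambda>_. r"] a r by simp
    also have "\<dots> = array_det k (\<lambda>p q. A $$ (i p, j q))"
      by (rule array_det_cong) (use lt entry in simp)
    finally show "0 \<le> array_det k (\<lambda>p q. A $$ (i p, j q))" .
  qed
  moreover have "hankel_mat A"
    unfolding hankel_mat_def by (rule exI[of _ "\<lambda>u. a * r ^ u"]) (simp add: A_def)
  moreover have "elements_mat A \<subseteq> {0<..<\<rho>}"
  proof
    fix x assume "x \<in> elements_mat A"
    then obtain p q where "p < dim_row A" "q < dim_col A" "x = A $$ (p, q)"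
      by (blast dest: elements_matD)
    then have "x = a * r ^ (p + q)" using carr entry by simp
    moreover have "a * r ^ (p + q) \<le> a * 1"
      by (intro mult_left_mono power_le_one) (use a r in auto)
    then have "a * r ^ (p + q) < \<rho>" using a by linarith
    ultimately show "x \<in> {0<..<\<rho>}" using a r by auto
  qed
  ultimately show "A \<in> HTN N {0<..<\<rho>}" using carr by (simp add: HTN_def)
  have "vec_space.rank N A \<le> 1"
    by (rule vec_space.rank_le_1_product_entries[OF carr, of "\<lambda>p. a * r ^ p" "\<lambda>q. r ^ q"])
       (use carr entry in \<open>simp add: power_add\<close>)
  moreover have "1 \<le> vec_space.rank N A"
  proof -
    have "submatrix A ((\<lambda>p. p) ` {..<1}) ((\<lambda>p. p) ` {..<1}) = mat 1 1 (\<lambda>(p, q). A $$ (p, q))"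
      by (rule submatrix_image) (use N carr in \<open>auto simp: strict_mono_on_def\<close>)
    then have "det (submatrix A {0} {0}) \<noteq> 0"
      using entry[OF N N] a by (simp add: lessThan_Suc det_single)
    moreover have "{x. x < N \<and> x \<in> {0}} = {0}" using N by auto
    ultimately show ?thesis using vec_space.rank_gt_minor[OF carr, of "{0}" "{0}"] by simp
  qed
  ultimately show "vec_space.rank N A = 1" by simp
qed

section \<open>The coefficient criterion\<close>

lemma threshold_pos:
  assumes e: "strict_mono_on {..N} e" and g: "\<And>l. l < N \<Longrightarrow> 0 < g l" and "0 < N" "0 < \<rho>"
  shows "0 < threshold N e g \<rho>"
proof -
  have inj: "inj_on e {..N}" using e by (rule strict_mono_on_imp_inj_on)
  have ne: "e l \<noteq> e m" if "l \<le> N" "m \<le> N" "l \<noteq> m" for l m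
    using inj_onD[OF inj, of l m] that by auto
  have "0 < node_ratio N e l" if "l < N" for l
    unfolding node_ratio_def using that by (intro prod_pos) (auto simp: ne)
  then show ?thesis
    unfolding threshold_def using assms by (intro sum_pos) auto
qed

theorem theorem9p3:
  fixes N :: nat and n c :: "nat \<Rightarrow> real" and M \<rho> c' :: real
    and f :: "real \<Rightarrow> real" and C :: real and R :: "real mat set"
  assumes "N > 0"
    and "strict_mono_on {..<N} n" and "n (N - 1) < M"
    and "\<rho> > 0"
  defines "f \<equiv> \<lambda>x. (\<Sum>j<N. c j * x powr n j) + c' * x powr M"
    and "C \<equiv> (\<Sum>j<N. (vandermonde (map n ([0..<j] @ [Suc j..<N]) @ [M]))\<^sup>2
                       / (vandermonde (map n [0..<N]))\<^sup>2
                       * (\<rho> powr (M - n j) / c j))"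
    and "R \<equiv> {A \<in> HTN N {0<..<\<rho>}. vec_space.rank N A = 1}"
  shows "(preserves_total_nonneg_on f R \<longleftrightarrow> preserves_positivity_on f R)
       \<and> (preserves_positivity_on f R \<longleftrightarrow>
            ((\<forall>j<N. c j \<ge> 0) \<and> c' \<ge> 0) \<or> ((\<forall>j<N. c j > 0) \<and> c' \<ge> - inverse C))"
proof -
  define e where "e = n(N := M)"
  define g where "g = c(N := c')"
  have e: "strict_mono_on {..N} e"
  proof (rule strict_mono_onI)
    fix p q assume pq: "p \<in> {..N}" "q \<in> {..N}" "p < q"
    show "e p < e q"
    proof (cases "q = N")
      case True
      have "n p \<le> n (N - 1)"
        by (rule strict_mono_on_leD[OF assms(2)]) (use pq True in auto)
      then show ?thesis using True pq assms(3) by (simp add: e_def)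
    next
      case False
      then show ?thesis using pq strict_mono_onD[OF assms(2), of p q] by (simp add: e_def)
    qed
  qed
  have f: "f (a * r ^ u) = (\<Sum>m\<le>N. (g m * a powr e m) * (r powr e m) ^ u)"
    if "0 < a" "0 < r" for a r u
  proof -
    have "(a * r ^ u) powr t = a powr t * (r powr t) ^ u" for t
      using that by (simp add: powr_mult powr_powr mult.commute flip: powr_realpow)
    then show ?thesis
      by (simp add: f_def e_def g_def lessThan_Suc_atMost[symmetric] mult.assoc)
  qed
  have C: "C = threshold N e g \<rho>"
    unfolding C_def threshold_def
  proof (rule sum.cong[OF refl])
    fix j assume "j \<in> {..<N}"
    then have j: "j < N" by simp
    have "map n ([0..<j] @ [Suc j..<N]) @ [M] = map e ([0..<j] @ [Suc j..<N]) @ [e N]"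
      "map n [0..<N] = map e [0..<N]"
      using j by (auto simp: e_def)
    then show "(vandermonde (map n ([0..<j] @ [Suc j..<N]) @ [M]))\<^sup>2
          / (vandermonde (map n [0..<N]))\<^sup>2 * (\<rho> powr (M - n j) / c j)
        = node_ratio N e j * (\<rho> powr (e N - e j) / g j)"
      using vandermonde_sq_ratio[OF strict_mono_on_imp_inj_on[OF e] j] j
      by (simp only:) (simp add: e_def g_def)
  qed
  let ?cond = "((\<forall>j<N. c j \<ge> 0) \<and> c' \<ge> 0) \<or> ((\<forall>j<N. c j > 0) \<and> c' \<ge> - inverse C)"
  have bound_iff: "- inverse C \<le> c' \<longleftrightarrow> - g N * threshold N e g \<rho> \<le> 1" if "\<forall>j<N. c j > 0"
  proof -
    have "0 < C" unfolding C
      by (rule threshold_pos[OF e]) (use that assms(1,4) in \<open>auto simp: g_def\<close>)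
    moreover have "g N = c'" by (simp add: g_def)
    ultimately show ?thesis by (simp add: C[symmetric] field_simps)
  qed
  have cond_imp_tn: "preserves_total_nonneg_on f R" if cond: ?cond
    unfolding preserves_total_nonneg_on_def
  proof
    fix A assume "A \<in> R"
    then have A: "A \<in> HTN N {0<..<\<rho>}" "vec_space.rank N A = 1" by (auto simp: R_def)
    then have carr: "A \<in> carrier_mat N N" by (simp add: HTN_def)
    obtain a r where ar: "0 < a" "a < \<rho>" "0 < r" "a * r ^ (2 * (N - 1)) < \<rho>"
      and entry: "\<And>p q. p < N \<Longrightarrow> q < N \<Longrightarrow> A $$ (p, q) = a * r ^ (p + q)"
      using rank_one_hankel_geometric[OF A assms(1)] by blast
    have carr': "map_mat f A \<in> carrier_mat N N" using carr by simp
    show "totally_nonneg (map_mat f A)"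
      unfolding totally_nonneg_iff_minors[OF carr']
    proof (intro allI impI)
      fix k and i j :: "nat \<Rightarrow> nat"
      assume ij: "strict_mono_on {..<k} i" "strict_mono_on {..<k} j"
        and lt: "\<forall>p<k. i p < N" "\<forall>p<k. j p < N"
      have "0 \<le> array_det k (\<lambda>p q. \<Sum>m\<le>N. (g m * a powr e m) * (r powr e m) ^ (i p + j q))"
      proof (cases "0 \<le> c'")
        case True
        then have "0 \<le> g m" if "m \<le> N" for m
          using cond that by (auto simp: g_def less_imp_le)
        then show ?thesis
          by (intro minor_nonneg_nonneg_coeffs[OF ij]) auto
      next
        case False
        then have pos: "\<forall>j<N. c j > 0" and le: "- inverse C \<le> c'" using cond by auto
        show ?thesis
        proof (rule minor_nonneg_neg_coeff[OF e _ _ _ ar(1) _ _ ar(3) ij])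
          show "0 < g l" if "l < N" for l using pos that by (simp add: g_def)
          show "g N < 0" using False by (simp add: g_def)
          show "- g N * threshold N e g \<rho> \<le> 1" using bound_iff[OF pos] le by blast
        qed (use ar lt in auto)
      qed
      also have "\<dots> = array_det k (\<lambda>p q. map_mat f A $$ (i p, j q))"
        by (rule array_det_cong) (use lt carr entry f[OF ar(1,3)] in simp)
      finally show "0 \<le> array_det k (\<lambda>p q. map_mat f A $$ (i p, j q))" .
    qed
  qed
  have tn_imp_psd: "preserves_positivity_on f R" if tn: "preserves_total_nonneg_on f R"
    unfolding preserves_positivity_on_def
  proof
    fix A assume A: "A \<in> R"
    then have carr: "A \<in> carrier_mat N N" and "hankel_mat A" by (auto simp: R_def HTN_def)
    then have "transpose_mat (map_mat f A) = map_mat f A"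
      by (intro eq_matI) (auto simp: hankel_mat_def add.commute)
    then show "pos_semidef (map_mat f A)"
      using totally_nonneg_symmetric_imp_psd[of "map_mat f A" N] carr tn A
      by (auto simp: preserves_total_nonneg_on_def)
  qed
  have psd_imp_cond: ?cond if psd: "preserves_positivity_on f R"
  proof -
    have form: "0 \<le> (\<Sum>p<N. \<Sum>q<N. v p * (\<Sum>m\<le>N. (g m * a powr e m) * (r powr e m) ^ (p + q)) * v q)"
      if a: "0 < a" "a < \<rho>" and r: "0 < r" "r < 1" for a r and v :: "nat \<Rightarrow> real"
    proof -
      let ?A = "mat N N (\<lambda>(p, q). a * r ^ (p + q))"
      have "?A \<in> R"
        unfolding R_def using geometric_hankel_rank_one[OF a r(1) _ assms(1)] r by simp
      then have "0 \<le> vec N v \<bullet> (map_mat f ?A *\<^sub>v vec N v)"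
        using psd unfolding preserves_positivity_on_def pos_semidef_def by auto
      also have "\<dots> = (\<Sum>p<N. \<Sum>q<N. vec N v $ p * map_mat f ?A $$ (p, q) * vec N v $ q)"
        by (rule quadratic_form_as_sum) auto
      also have "\<dots> = (\<Sum>p<N. \<Sum>q<N. v p * (\<Sum>m\<le>N. (g m * a powr e m) * (r powr e m) ^ (p + q)) * v q)"
        by (intro sum.cong refl) (simp add: f[OF a(1) r(1)])
      finally show ?thesis .
    qed
    have "(\<forall>l<N. 0 \<le> g l) \<and> (g N < 0 \<longrightarrow> (\<forall>l<N. 0 < g l) \<and> - g N * threshold N e g \<rho> \<le> 1)"
      by (rule coefficients_of_psd[OF form e assms(1,4)])
    then have "\<forall>j<N. 0 \<le> c j"
      "c' < 0 \<longrightarrow> (\<forall>j<N. 0 < c j) \<and> - g N * threshold N e g \<rho> \<le> 1"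
      by (auto simp: g_def)
    then show ?thesis using bound_iff by (cases "c' < 0") auto
  qed
  show ?thesis using cond_imp_tn tn_imp_psd psd_imp_cond by blast
qed

end
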